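(* Let $\Gamma = (\Gamma, \le, \mu, (\varphi_x)_{x\in V})$ be the trickle graph with vertex set $V=\mathbb Z[\frac12]\sqcup\{\infty\}$ defined in the context (the complete graph on $V$, with the usual total order on $\mathbb Z[\frac12]$ and $\infty$ as greatest element, $\mu\equiv\infty$, and $\varphi_x$ given by the homeomorphism $h_x$). Then $\mathrm{Tr} (\Gamma)$ is isomorphic to Thompson group $F$.
   Context: **Trickle graphs.** For a simplicial graph $\Gamma$ with vertex set $V(\Gamma)$ and edge set $E(\Gamma)$, $\mathrm{star}_x(\Gamma)$ is the full subgraph spanned by $x$ and all vertices adjacent to $x$. A trickle graph is a quadruple $(\Gamma,\le,\mu,(\varphi_x)_{x\in V(\Gamma)})$ where $\Gamma$ is a simplicial graph, $\le$ is a partial order on $V(\Gamma)$, $\mu:V(\Gamma)\to\mathbb N_{\ge 2}\cup\{\infty\}$ is a labeling, and each $\varphi_x$ is a graph automorphism of $\mathrm{star}_x(\Gamma)$, such that, writing $x||y$ if $x\not\le y$ and $y\not\le x$, and $E_{||}(\Gamma)=\{\{x,y\}\in E(\Gamma)\mid x||y\}$: (a) if $x<y$ then $\{x,y\}\in E(\Gamma)$; (b) if $\{x,y\}\in E_{||}(\Gamma)$ and $z\le y$, then $\{x,z\}\in E_{||}(\Gamma)$; (c) for $y,z\in \mathrm{star}_x(\Gamma)$: $z\le y$ iff $\varphi_x(z)\le\varphi_x(y)$; (d) for $y\in\mathrm{star}_x(\Gamma)$: if $\varphi_x(y)\ne y$ then $y<x$; (e) if $\mu(x)$ is finite, then $\varphi_x$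 has finite order dividing $\mu(x)$; (f) $\mu(\varphi_x(y))=\mu(y)$ for $y\in \mathrm{star}_x(\Gamma)$; (g) if $z<y<x$ then $(\varphi_x\circ\varphi_y)(z)=(\varphi_{y'}\circ\varphi_x)(z)$ where $y'=\varphi_x(y)$. The trickle group is $\mathrm{Tr}(\Gamma)=\langle V(\Gamma)\mid x^{\mu(x)}=1 \text{ if }\mu(x)\ne\infty,\ \varphi_x(y)\,x=\varphi_y(x)\,y\text{ for }\{x,y\}\in E(\Gamma)\rangle$. **Thompson group $F$.** $F$ is the group (under composition) of orientation preserving piecewise linear homeomorphisms $f:\mathbb R\to\mathbb R$ for which there exist $u_0<\dots<u_n$ and $v_0<\dots<v_n$ in $\mathbb Z[\frac12]$ such that $f$ maps $[u_{i-1},u_i]$ linearly onto $[v_{i-1},v_i]$ for $1\le i\le n$, is the translation $t\mapsto t+v_0-u_0$ on $(-\infty,u_0]$, and is the translation $t\mapsto t+v_n-u_n$ on $[u_n,+\infty)$. **The trickle graph.** Define $V_p\subseteq\mathbb Z[\frac12]$ and $s_p,t_p:V_p\to V_p$ for $p\in\mathbb N$ by induction. $V_0=\mathbb Z$, $s_0(x)=x+1$, $t_0(x)=x-1$. Given $V_p,s_p$: for $x\in V_p$, with $x'=s_p(x)$, and $k\in\mathbb N$ (including $0$), let $u_{p+1,k}(x)=x'-\frac{x'-x}{2^k}$; set $V_{p+1}=\bigsqcup_{x\in V_p}\{u_{p+1,k}(x)\mid k\in\mathbb N\}$ and $s_{p+1}(u_{p+1,k}(x))=u_{p+1,k+1}(x)$.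 Then $V_p\subset V_{p+1}$ and $\bigcup_pV_p=\mathbb Z[\frac12]$. For $p\ge1$ and $x\in V_p$: if $x\in V_{p-1}$ set $t_p(x)=t_{p-1}(x)$; otherwise $x=u_{p,k}(y)$ with $y\in V_{p-1}$, $k\ge1$, and $t_p(x)=u_{p,k-1}(y)$. Let $h_\infty(t)=t-1$. For $x\in\mathbb Z[\frac12]$, let $p\ge0$ be least with $x\in V_p$, let $x'=t_p(x)$, and for $k\ge0$ let $v_k=s_{p+1}^k(x')$ and $v_{-k}=t_p^k(x')$; then $(v_k)_{k\in\mathbb Z}$ is increasing with limits $-\infty$ and $x$ as $k\to-\infty$ and $k\to+\infty$. Let $h_x:\mathbb R\to\mathbb R$ be the homeomorphism mapping $[v_k,v_{k+1}]$ linearly (orientation preserving) onto $[v_{k-1},v_k]$ for all $k\in\mathbb Z$ and equal to the identity on $[x,+\infty)$. Each $h_x$ ($x\in V$) maps $\mathbb Z[\frac12]$ onto itself. $\Gamma$ is the complete graph on $V=\mathbb Z[\frac12]\sqcup\{\infty\}$; $\le$ is the total order induced from $\mathbb R$ on $\mathbb Z[\frac12]$ with $x<\infty$ for all $x\in\mathbb Z[\frac12]$; $\mu(x)=\infty$ for all $x$; $\varphi_x(\infty)=\infty$ and $\varphi_x(y)=h_x(y)$ for $y\in\mathbb Z[\frac12]$. This quadruple is a trickle graph.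
   Formalization: Thompson's group F is taken in its standard form: slopes of the linear pieces are powers of 2 and the translations near −∞ and +∞ are by integers; without these conditions the described set of maps is not closed under composition. *)

theory Defs
  imports "HOL-Analysis.Analysis" "HOL-Algebra.Algebra"
begin

section \<open>Group presentations\<close>

text \<open>Words are lists of signed letters: \<open>(s, True)\<close> stands for the generator \<open>s\<close> and
  \<open>(s, False)\<close> for its inverse.  A relation \<open>u = v\<close> is a pair \<open>(u, v)\<close> of words.\<close>

type_synonym 's word = "('s \<times> bool) list"

definition words :: "'s set \<Rightarrow> 's word set" where
  "words S = lists (S \<times> UNIV)"

inductive pres_eq :: "'s set \<Rightarrow> ('s word \<times> 's word) set \<Rightarrow> 's word \<Rightarrow> 's word \<Rightarrow> bool"
  for S R where
  rel: "(u, v) \<in> R \<Longrightarrow> u \<in> words S \<Longrightarrow> v \<in> words S \<Longrightarrow> pres_eq S R u v"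
| cancel: "s \<in> S \<Longrightarrow> pres_eq S R [(s, e), (s, \<not> e)] []"
| refl: "u \<in> words S \<Longrightarrow> pres_eq S R u u"
| sym: "pres_eq S R u v \<Longrightarrow> pres_eq S R v u"
| trans: "pres_eq S R u v \<Longrightarrow> pres_eq S R v w \<Longrightarrow> pres_eq S R u w"
| append: "pres_eq S R u u' \<Longrightarrow> pres_eq S R v v' \<Longrightarrow> pres_eq S R (u @ v) (u' @ v')"

definition pres_class :: "'s set \<Rightarrow> ('s word \<times> 's word) set \<Rightarrow> 's word \<Rightarrow> 's word set" where
  "pres_class S R u = {v. pres_eq S R u v}"

definition presented_group ::
  "'s set \<Rightarrow> ('s word \<times> 's word) set \<Rightarrow> 's word set monoid" where
  "presented_group S R =
    \<lparr>carrier = pres_class S R ` words S,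
     mult = (\<lambda>A B. {w. \<exists>u\<in>A. \<exists>v\<in>B. pres_eq S R (u @ v) w}),
     one = pres_class S R []\<rparr>"

lemma pres_class_mult:
  assumes "u \<in> words S" "v \<in> words S"
  shows "pres_class S R u \<otimes>\<^bsub>presented_group S R\<^esub> pres_class S R v = pres_class S R (u @ v)"
proof -
  have "pres_eq S R u u" "pres_eq S R v v"
    using assms by (auto intro: pres_eq.refl)
  then show ?thesis
    by (auto simp: presented_group_def pres_class_def intro: pres_eq.append pres_eq.trans)
qed

lemma pres_class_eqI: "pres_eq S R u v \<Longrightarrow> pres_class S R u = pres_class S R v"
  by (auto simp: pres_class_def intro: pres_eq.sym pres_eq.trans)

lemma pres_left_inverse:
  "u \<in> words S \<Longrightarrow> \<exists>v\<in>words S. pres_eq S R (v @ u) []"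
proof (induction u)
  case Nil
  then show ?case by (auto simp: words_def intro!: bexI[of _ "[]"] pres_eq.refl)
next
  case (Cons a u)
  obtain s e where a: "a = (s, e)" by force
  have s: "s \<in> S" and u: "u \<in> words S" using Cons.prems a by (auto simp: words_def)
  obtain v where v: "v \<in> words S" "pres_eq S R (v @ u) []" using Cons.IH u by blast
  have c: "pres_eq S R [(s, \<not> e), (s, e)] []" using pres_eq.cancel[OF s, of R "\<not> e"] by simp
  have "pres_eq S R (v @ ([(s, \<not> e), (s, e)] @ u)) (v @ ([] @ u))"
    by (intro pres_eq.append c pres_eq.refl u v)
  then have "pres_eq S R ((v @ [(s, \<not> e)]) @ a # u) []"
    using v(2) a pres_eq.trans by fastforce
  moreover have "v @ [(s, \<not> e)] \<in> words S" using v s by (auto simp: words_def)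
  ultimately show ?case by blast
qed

lemma group_presented_group: "group (presented_group S R)"
proof (rule groupI)
  let ?G = "presented_group S R"
  have car: "carrier ?G = pres_class S R ` words S" by (simp add: presented_group_def)
  have one: "\<one>\<^bsub>?G\<^esub> = pres_class S R []" by (simp add: presented_group_def)
  have app: "u @ v \<in> words S" if "u \<in> words S" "v \<in> words S" for u v
    using that by (auto simp: words_def)
  have nil: "[] \<in> words S" by (simp add: words_def)
  show "\<one>\<^bsub>?G\<^esub> \<in> carrier ?G" using nil by (simp add: car one)
  show "x \<otimes>\<^bsub>?G\<^esub> y \<in> carrier ?G" if "x \<in> carrier ?G" "y \<in> carrier ?G" for x y
    using that by (auto simp: car pres_class_mult app)
  show "x \<otimes>\<^bsub>?G\<^esub> y \<otimes>\<^bsub>?G\<^esub> z = x \<otimes>\<^bsub>?G\<^esub> (y \<otimes>\<^bsub>?G\<^esub> z)"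
    if "x \<in> carrier ?G" "y \<in> carrier ?G" "z \<in> carrier ?G" for x y z
    using that by (auto simp: car pres_class_mult app)
  show "\<one>\<^bsub>?G\<^esub> \<otimes>\<^bsub>?G\<^esub> x = x" if "x \<in> carrier ?G" for x
    using that by (auto simp: car one pres_class_mult nil)
  show "\<exists>y\<in>carrier ?G. y \<otimes>\<^bsub>?G\<^esub> x = \<one>\<^bsub>?G\<^esub>" if "x \<in> carrier ?G" for x
  proof -
    obtain u where u: "u \<in> words S" "x = pres_class S R u" using \<open>x \<in> carrier ?G\<close> unfolding car by auto
    obtain v where "v \<in> words S" "pres_eq S R (v @ u) []" using pres_left_inverse[OF u(1)] by blast
    then show ?thesis using u by (auto simp: car one pres_class_mult intro!: pres_class_eqI)
  qed
qed


section \<open>Trickle graphs and trickle groups\<close>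

record 'v trickle_data =
  verts :: "'v set"
  edges :: "'v set set"
  le :: "'v rel"
  label :: "'v \<Rightarrow> enat"
  aut :: "'v \<Rightarrow> 'v \<Rightarrow> 'v"

definition star :: "('v, 'm) trickle_data_scheme \<Rightarrow> 'v \<Rightarrow> 'v set" where
  "star G x = {x} \<union> {y \<in> verts G. {x, y} \<in> edges G}"

definition lt :: "('v, 'm) trickle_data_scheme \<Rightarrow> 'v \<Rightarrow> 'v \<Rightarrow> bool" where
  "lt G x y \<longleftrightarrow> (x, y) \<in> le G \<and> x \<noteq> y"

definition par_edges :: "('v, 'm) trickle_data_scheme \<Rightarrow> 'v set set" where
  "par_edges G = {{x, y} | x y. {x, y} \<in> edges G \<and> (x, y) \<notin> le G \<and> (y, x) \<notin> le G}"

definition trickle_graph :: "('v, 'm) trickle_data_scheme \<Rightarrow> bool" where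
  "trickle_graph G \<longleftrightarrow>
    edges G \<subseteq> {{x, y} | x y. x \<in> verts G \<and> y \<in> verts G \<and> x \<noteq> y} \<and>
    partial_order_on (verts G) (le G) \<and>
    (\<forall>x\<in>verts G. 2 \<le> label G x) \<and>
    (\<forall>x\<in>verts G. bij_betw (aut G x) (star G x) (star G x) \<and>
      (\<forall>y\<in>star G x. \<forall>z\<in>star G x.
        {y, z} \<in> edges G \<longleftrightarrow> {aut G x y, aut G x z} \<in> edges G)) \<and>
    \<comment> \<open>(a)\<close>
    (\<forall>x y. lt G x y \<longrightarrow> {x, y} \<in> edges G) \<and>
    \<comment> \<open>(b)\<close>
    (\<forall>x y z. {x, y} \<in> par_edges G \<and> (z, y) \<in> le G \<longrightarrow> {x, z} \<in> par_edges G) \<and>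
    \<comment> \<open>(c)\<close>
    (\<forall>x\<in>verts G. \<forall>y\<in>star G x. \<forall>z\<in>star G x.
      (z, y) \<in> le G \<longleftrightarrow> (aut G x z, aut G x y) \<in> le G) \<and>
    \<comment> \<open>(d)\<close>
    (\<forall>x\<in>verts G. \<forall>y\<in>star G x. aut G x y \<noteq> y \<longrightarrow> lt G y x) \<and>
    \<comment> \<open>(e); \<open>group.ord\<close> is 0 for elements of infinite order, and 0 divides no label\<close>
    (\<forall>x\<in>verts G. \<forall>m. label G x = enat m \<longrightarrow>
      group.ord (BijGroup (star G x)) (restrict (aut G x) (star G x)) dvd m) \<and>
    \<comment> \<open>(f)\<close>
    (\<forall>x\<in>verts G. \<forall>y\<in>star G x. label G (aut G x y) = label G y) \<and>
    \<comment> \<open>(g)\<close>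
    (\<forall>x y z. lt G z y \<and> lt G y x \<longrightarrow>
      aut G x (aut G y z) = aut G (aut G x y) (aut G x z))"

definition trickle_group :: "('v, 'm) trickle_data_scheme \<Rightarrow> 'v word set monoid" where
  "trickle_group G = presented_group (verts G)
    ({(replicate m (x, True), []) | x m. x \<in> verts G \<and> label G x = enat m} \<union>
     {([(aut G x y, True), (x, True)], [(aut G y x, True), (y, True)]) | x y.
        {x, y} \<in> edges G})"


section \<open>Thompson's group F\<close>

definition dyadics :: "real set" where
  "dyadics = {of_int m / 2 ^ k | (m :: int) (k :: nat). True}"

text \<open>The orientation preserving affine bijection from \<open>[a, b]\<close> onto \<open>[c, d]\<close>, for
  \<open>a < b\<close> and \<open>c < d\<close>.\<close>

definition linear_onto :: "(real \<Rightarrow> real) \<Rightarrow> real \<Rightarrow> real \<Rightarrow> real \<Rightarrow> real \<Rightarrow> bool" where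
  "linear_onto f a b c d \<longleftrightarrow> (\<forall>t\<in>{a..b}. f t = c + (d - c) / (b - a) * (t - a))"

text \<open>Besides dyadic breakpoints with dyadic images, the maps in \<open>F\<close> have slopes that are
  powers of 2 and translate by integers near \<open>-\<infinity>\<close> and \<open>+\<infinity>\<close>.  Neither condition follows
  from the others: with arbitrary slopes one loses closure under composition (a breakpoint
  1 pulled back along a piece of slope 3 starting at 0 becomes 1/3), and with arbitrary
  dyadic translations the group of germs at \<open>-\<infinity>\<close> is not finitely generated.\<close>

definition thompson_map :: "(real \<Rightarrow> real) \<Rightarrow> bool" where
  "thompson_map f \<longleftrightarrow>
    strict_mono f \<and> (\<exists>g. homeomorphism UNIV UNIV f g) \<and>
    (\<exists>(n :: nat) (u :: nat \<Rightarrow> real) (v :: nat \<Rightarrow> real).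
      strict_mono_on {0..n} u \<and> strict_mono_on {0..n} v \<and>
      u ` {0..n} \<subseteq> dyadics \<and> v ` {0..n} \<subseteq> dyadics \<and>
      (\<forall>i\<in>{1..n}. linear_onto f (u (i - 1)) (u i) (v (i - 1)) (v i) \<and>
        (\<exists>k :: int. (v i - v (i - 1)) / (u i - u (i - 1)) = 2 powi k)) \<and>
      v 0 - u 0 \<in> \<int> \<and> (\<forall>t\<le>u 0. f t = t + v 0 - u 0) \<and>
      v n - u n \<in> \<int> \<and> (\<forall>t\<ge>u n. f t = t + v n - u n))"

definition thompson_F :: "(real \<Rightarrow> real) monoid" where
  "thompson_F = \<lparr>carrier = {f. thompson_map f}, mult = (\<circ>), one = id\<rparr>"


section \<open>The trickle graph on the dyadic rationals with a point at infinity\<close>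

text \<open>\<open>dyV p\<close>, \<open>dyS p\<close> and \<open>dyT p\<close> are \<open>V\<^sub>p\<close>, \<open>s\<^sub>p\<close> and \<open>t\<^sub>p\<close>; the last two are only meaningful on
  \<open>V\<^sub>p\<close>.  The descriptions are definite because every element of \<open>V\<^sub>p\<^sub>+\<^sub>1\<close> is \<open>u\<^sub>p\<^sub>+\<^sub>1\<^sub>,\<^sub>k(x)\<close> for exactly
  one \<open>x\<close> in \<open>V\<^sub>p\<close> and one \<open>k\<close>.\<close>

fun dyV :: "nat \<Rightarrow> real set" and dyS :: "nat \<Rightarrow> real \<Rightarrow> real" where
  "dyV 0 = \<int>"
| "dyV (Suc p) = {dyS p x - (dyS p x - x) / 2 ^ k | x (k :: nat). x \<in> dyV p}"
| "dyS 0 z = z + 1"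
| "dyS (Suc p) z = (THE w. \<exists>x (k :: nat). x \<in> dyV p \<and>
     z = dyS p x - (dyS p x - x) / 2 ^ k \<and> w = dyS p x - (dyS p x - x) / 2 ^ (k + 1))"

text \<open>\<open>dyU p k x\<close> is \<open>u\<^sub>p\<^sub>+\<^sub>1\<^sub>,\<^sub>k(x)\<close>; note the shift in the first index.\<close>

definition dyU :: "nat \<Rightarrow> nat \<Rightarrow> real \<Rightarrow> real" where
  "dyU p k x = dyS p x - (dyS p x - x) / 2 ^ k"

fun dyT :: "nat \<Rightarrow> real \<Rightarrow> real" where
  "dyT 0 x = x - 1"
| "dyT (Suc p) x = (if x \<in> dyV p then dyT p x
     else (THE w. \<exists>y k. y \<in> dyV p \<and> 1 \<le> k \<and> x = dyU p k y \<and> w = dyU p (k - 1) y))"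

definition dy_level :: "real \<Rightarrow> nat" where
  "dy_level x = (LEAST p. x \<in> dyV p)"

definition dy_seq :: "real \<Rightarrow> int \<Rightarrow> real" where
  "dy_seq x k = (let p = dy_level x; x' = dyT p x in
     if 0 \<le> k then (dyS (p + 1) ^^ nat k) x' else (dyT p ^^ nat (- k)) x')"

definition dy_homeo :: "real \<Rightarrow> real \<Rightarrow> real" where
  "dy_homeo x = (THE f.
     (\<forall>k. linear_onto f (dy_seq x k) (dy_seq x (k + 1)) (dy_seq x (k - 1)) (dy_seq x k)) \<and>
     (\<forall>t\<ge>x. f t = t))"

definition dy_homeo_infinity :: "real \<Rightarrow> real" where
  "dy_homeo_infinity t = t - 1"

definition dy_verts :: "ereal set" where
  "dy_verts = ereal ` dyadics \<union> {\<infinity>}"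

definition dy_aut :: "ereal \<Rightarrow> ereal \<Rightarrow> ereal" where
  "dy_aut x y =
    (if y = \<infinity> then \<infinity>
     else if x = \<infinity> then ereal (dy_homeo_infinity (real_of_ereal y))
     else ereal (dy_homeo (real_of_ereal x) (real_of_ereal y)))"

definition dyadic_trickle_graph :: "ereal trickle_data" where
  "dyadic_trickle_graph =
    \<lparr>verts = dy_verts,
     edges = {{x, y} | x y. x \<in> dy_verts \<and> y \<in> dy_verts \<and> x \<noteq> y},
     le = {(x, y). x \<in> dy_verts \<and> y \<in> dy_verts \<and> x \<le> y},
     label = (\<lambda>_. \<infinity>),
     aut = dy_aut\<rparr>"

end

theory Submission
  imports Defs
begin

text \<open>
  Every vertex \<open>x\<close> acts on the line through its homeomorphism \<open>h\<^sub>x\<close>, and the isomorphism sends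
  the generator \<open>x\<close> to \<open>h\<^sub>x\<close>. Three things have to be seen: the \<open>h\<^sub>x\<close> satisfy the relations, only
  trivial words act trivially, and the \<open>h\<^sub>x\<close> generate \<open>F\<close>.

  \<^bold>\<open>Relations.\<close> Let the predecessor of a dyadic number with reduced denominator \<open>2\<^sup>n\<close> be that
  number minus \<open>1/2\<^sup>n\<close>. All the maps \<open>t\<^sub>p\<close> are restrictions of this one map, and the two-sided sequence
  that \<open>h\<^sub>x\<close> shifts consists of the iterated predecessors of \<open>x\<close> and of the repeated halvings of
  the interval from the predecessor of \<open>x\<close> to \<open>x\<close>. Hence an increasing bijection \<open>f\<close> that commutes with
  the predecessor and is linear between the predecessor of \<open>y\<close> and \<open>y\<close>, for all dyadic \<open>y\<close>
  below some bound, carries the sequence of such a \<open>y\<close> to the one of \<open>f y\<close> and so conjugates \<open>h\<^sub>y\<close> to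
  \<open>h\<^sub>f\<^sub>(\<^sub>y\<^sub>)\<close> (\<open>dy_homeo_conj\<close>). The map \<open>h\<^sub>x\<close> itself has this property below \<open>x\<close>
  (\<open>dy_homeo_properties\<close>): for an integer \<open>x\<close> it is given by three simple formulas
  (\<open>int_shift\<close>), and for \<open>x\<close> strictly between the integers \<open>m - 1\<close> and \<open>m\<close> the map \<open>h\<^sub>m\<close> halves the
  denominator of \<open>x\<close>, so that \<open>h\<^sub>x\<close> is a conjugate by \<open>h\<^sub>m\<close> of a map already understood. This gives
  the last condition on a trickle graph and the relations of the trickle group; the same induction
  shows that every \<open>h\<^sub>x\<close> lies in \<open>F\<close>.

  \<^bold>\<open>Injectivity.\<close> By the relations the largest vertex \<open>x\<close> of a word can be moved to the right past
  smaller letters, which stay smaller than \<open>x\<close> and keep their number. So every word equals \<open>u x\<^sup>a\<close>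
  with \<open>u\<close> made of vertices below \<open>x\<close> (\<open>collect_letter\<close>). Near \<open>x\<close> the word \<open>u\<close> acts as the identity,
  whereas a nontrivial power of \<open>x\<close> moves every point below \<open>x\<close>. If the word acts trivially, then
  \<open>a = 0\<close>, and an induction on the length applies to \<open>u\<close> (\<open>trivial_word_map\<close>).

  \<^bold>\<open>Surjectivity.\<close> Consider a map of the line that sends each unit interval between integers linearly
  onto a standard dyadic interval \<open>[c/2\<^sup>k, (c+1)/2\<^sup>k]\<close> and is an integer translation near both ends.
  If some image is shorter than one, then some two adjacent images of minimal length are the halves
  of a standard interval, and composing with an \<open>h\<^sub>m\<close> merges them. After finitely many steps a
  translation is left, which is a power of \<open>h\<^sub>\<infinity>\<close>
  (\<open>standard_unit_images_in_word_maps\<close>). An arbitrary \<open>f\<close> in \<open>F\<close> sends all sufficiently small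
  standard intervals to standard intervals. If \<open>p\<close> shrinks unit intervals onto such small ones, then
  \<open>p\<close> and \<open>f \<circ> p\<close> are both of the kind just treated (\<open>thompson_like_in_word_maps\<close>).
\<close>


section \<open>Dyadic numbers and their predecessors\<close>

text \<open>The reduced denominator of a dyadic \<open>x\<close> is \<open>2 ^ dy_exp x\<close>.\<close>

definition dy_exp :: "real \<Rightarrow> nat" where
  "dy_exp x = (LEAST n. x * 2 ^ n \<in> \<int>)"

definition dy_pred :: "real \<Rightarrow> real" where
  "dy_pred x = x - 1 / 2 ^ dy_exp x"

lemma dyadics_iff: "x \<in> dyadics \<longleftrightarrow> (\<exists>n. x * 2 ^ n \<in> \<int>)"
proof
  assume "\<exists>n. x * 2 ^ n \<in> \<int>"
  then obtain n j where "x * 2 ^ n = of_int j" by (auto elim: Ints_cases)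
  then have "x = of_int j / 2 ^ n" by (simp add: field_simps)
  then show "x \<in> dyadics" by (auto simp: dyadics_def)
next
  assume "x \<in> dyadics"
  then obtain j k where "x = of_int j / 2 ^ k" by (auto simp: dyadics_def)
  then have "x * 2 ^ k = of_int j" by simp
  then show "\<exists>n. x * 2 ^ n \<in> \<int>" by (metis Ints_of_int)
qed

lemma dyadicsI: "x * 2 ^ n \<in> \<int> \<Longrightarrow> x \<in> dyadics"
  by (auto simp: dyadics_iff)

lemma dyadics_frac [simp]: "of_int j / 2 ^ n \<in> dyadics"
  by (auto simp: dyadics_def)

lemma dyadics_of_int [simp]: "of_int j \<in> dyadics"
  using dyadics_frac[of j 0] by simp

lemma Ints_times_power2_mono: "x * 2 ^ n \<in> \<int> \<Longrightarrow> n \<le> k \<Longrightarrow> (x :: real) * 2 ^ k \<in> \<int>"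
proof -
  assume "x * 2 ^ n \<in> \<int>" "n \<le> k"
  then have "x * 2 ^ n * 2 ^ (k - n) \<in> \<int>" by simp
  then show ?thesis using \<open>n \<le> k\<close> by (simp add: mult.assoc flip: power_add)
qed

lemma dy_exp_le_iff:
  assumes "x \<in> dyadics"
  shows "dy_exp x \<le> n \<longleftrightarrow> x * 2 ^ n \<in> \<int>"
proof -
  have "x * 2 ^ dy_exp x \<in> \<int>"
    using assms unfolding dyadics_iff dy_exp_def by (rule LeastI_ex)
  then show ?thesis
    by (auto simp: dy_exp_def intro: Ints_times_power2_mono Least_le)
qed

lemma dy_exp_eqI:
  assumes "x \<in> dyadics" "\<And>n. x * 2 ^ n \<in> \<int> \<longleftrightarrow> N \<le> n"
  shows "dy_exp x = N"
  using assms dy_exp_le_iff[OF assms(1)] by (meson order_antisym order_refl)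

lemma dyadic_times_power2_dy_exp: "x \<in> dyadics \<Longrightarrow> x * 2 ^ dy_exp x \<in> \<int>"
  using dy_exp_le_iff by blast

lemma dy_exp_odd:
  assumes "odd j"
  shows "dy_exp (of_int j / 2 ^ n) = n"
proof (rule dy_exp_eqI)
  fix k
  show "real_of_int j / 2 ^ n * 2 ^ k \<in> \<int> \<longleftrightarrow> n \<le> k"
  proof
    assume "real_of_int j / 2 ^ n * 2 ^ k \<in> \<int>"
    then obtain i where i: "real_of_int j / 2 ^ n * 2 ^ k = of_int i" by (auto elim: Ints_cases)
    show "n \<le> k"
    proof (rule ccontr)
      assume "\<not> n \<le> k"
      then obtain d where d: "n = k + Suc d" by (metis add_Suc_right less_iff_Suc_add not_le)
      from i have "real_of_int j * 2 ^ k = of_int i * 2 ^ n" by (simp add: field_simps)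
      then have "real_of_int j = of_int (i * 2 ^ Suc d)" by (simp add: d power_add)
      then have "j = i * 2 ^ Suc d" by linarith
      with assms show False by simp
    qed
  next
    assume "n \<le> k"
    then have "real_of_int j / 2 ^ n * 2 ^ k = of_int (j * 2 ^ (k - n))"
      by (auto simp: le_iff_add power_add)
    then show "real_of_int j / 2 ^ n * 2 ^ k \<in> \<int>" by (metis Ints_of_int)
  qed
qed simp

lemma dy_exp_of_int [simp]: "dy_exp (of_int j) = 0"
  by (rule dy_exp_eqI) auto

lemma dy_exp_eq_0_iff: "x \<in> dyadics \<Longrightarrow> dy_exp x = 0 \<longleftrightarrow> x \<in> \<int>"
  using dy_exp_le_iff[of x 0] by simp

lemma dy_pred_of_int [simp]: "dy_pred (of_int j) = of_int j - 1"
  by (simp add: dy_pred_def)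

lemma dy_pred_odd: "odd j \<Longrightarrow> dy_pred (of_int j / 2 ^ n) = of_int (j - 1) / 2 ^ n"
  by (simp add: dy_pred_def dy_exp_odd diff_divide_distrib)

lemma dy_pred_less [simp]: "dy_pred x < x"
  by (simp add: dy_pred_def)

lemma dy_pred_times_power2: "dy_pred x * 2 ^ dy_exp x = x * 2 ^ dy_exp x - 1"
  by (simp add: dy_pred_def algebra_simps)

lemma dyadics_dy_pred [simp]:
  assumes "x \<in> dyadics"
  shows "dy_pred x \<in> dyadics"
proof (rule dyadicsI)
  show "dy_pred x * 2 ^ dy_exp x \<in> \<int>"
    using dyadic_times_power2_dy_exp[OF assms] by (simp add: dy_pred_times_power2)
qed

lemma dy_exp_dy_pred_le: "x \<in> dyadics \<Longrightarrow> dy_exp (dy_pred x) \<le> dy_exp x"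
  using dyadic_times_power2_dy_exp[of x] by (simp add: dy_exp_le_iff dy_pred_times_power2)

lemma dyadics_funpow_dy_pred [simp]: "x \<in> dyadics \<Longrightarrow> (dy_pred ^^ i) x \<in> dyadics"
  by (induction i) auto

lemma funpow_dy_pred_le:
  assumes "x \<in> dyadics"
  shows "(dy_pred ^^ i) x \<le> x - real i / 2 ^ dy_exp x \<and> dy_exp ((dy_pred ^^ i) x) \<le> dy_exp x"
proof (induction i)
  case (Suc i)
  let ?y = "(dy_pred ^^ i) x"
  have "1 / 2 ^ dy_exp x \<le> (1 :: real) / 2 ^ dy_exp ?y"
    using Suc by (intro divide_left_mono power_increasing) auto
  then have "dy_pred ?y \<le> ?y - 1 / 2 ^ dy_exp x" by (simp add: dy_pred_def)
  moreover have "dy_exp (dy_pred ?y) \<le> dy_exp ?y" using assms by (intro dy_exp_dy_pred_le) simp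
  ultimately show ?case using Suc by (auto simp: field_simps)
qed simp

text \<open>The predecessors of a dyadic number are unbounded below because they all have a
  denominator dividing the one of the number that they start from.\<close>

lemma funpow_dy_pred_unbounded:
  assumes "x \<in> dyadics"
  shows "\<exists>i. (dy_pred ^^ i) x \<le> t"
proof -
  obtain i where "(x - t) * 2 ^ dy_exp x < real i" using reals_Archimedean2 by blast
  then have "x - real i / 2 ^ dy_exp x \<le> t" by (simp add: field_simps)
  then show ?thesis using funpow_dy_pred_le[OF assms] order_trans by blast
qed

text \<open>Both sides are integers over the denominator of \<open>x\<close>, and the predecessor is one unit below \<open>x\<close>.\<close>

lemma of_int_le_dy_pred:
  assumes "x \<in> dyadics" "of_int m < x"
  shows "of_int m \<le> dy_pred x"
proof -
  obtain j where j: "x * 2 ^ dy_exp x = of_int j"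
    using dyadic_times_power2_dy_exp[OF assms(1)] by (auto elim: Ints_cases)
  have "of_int m * 2 ^ dy_exp x < x * 2 ^ dy_exp x" using assms(2) by simp
  then have "real_of_int (m * 2 ^ dy_exp x) < of_int j" by (simp add: j)
  then have "m * 2 ^ dy_exp x \<le> j - 1" by linarith
  then have "real_of_int (m * 2 ^ dy_exp x) \<le> of_int (j - 1)" by (simp only: of_int_le_iff)
  then have "of_int m * 2 ^ dy_exp x \<le> dy_pred x * 2 ^ dy_exp x"
    by (simp add: dy_pred_times_power2 j)
  then show ?thesis by simp
qed

lemma dyadics_add: assumes "x \<in> dyadics" "y \<in> dyadics" shows "x + y \<in> dyadics"
proof -
  obtain n k where "x * 2 ^ n \<in> \<int>" "y * 2 ^ k \<in> \<int>" using assms by (auto simp: dyadics_iff)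
  then have "x * 2 ^ max n k \<in> \<int>" "y * 2 ^ max n k \<in> \<int>"
    by (auto intro: Ints_times_power2_mono)
  then have "(x + y) * 2 ^ max n k \<in> \<int>" by (simp add: distrib_right)
  then show ?thesis by (rule dyadicsI)
qed

lemma dyadics_minus_of_int: assumes "x \<in> dyadics" shows "x - of_int m \<in> dyadics"
  using dyadics_add[OF assms dyadics_of_int[of "- m"]] by simp

lemma dy_pred_minus_of_int:
  assumes "x \<in> dyadics"
  shows "dy_pred (x - of_int m) = dy_pred x - of_int m"
proof -
  have "dy_exp (x - of_int m) = dy_exp x"
    using assms
    by (intro dy_exp_eqI dyadics_minus_of_int) (simp_all add: left_diff_distrib dy_exp_le_iff)
  then show ?thesis by (simp add: dy_pred_def)
qed

text \<open>The maps \<open>t \<mapsto> 2 t - m\<close> halve the denominator of a non-integral dyadic number. This is what makes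
  inductions on \<open>dy_exp\<close> possible.\<close>

lemma dy_double:
  assumes "x \<in> dyadics" "x \<notin> \<int>"
  shows "2 * x - of_int m \<in> dyadics" and "dy_exp x = Suc (dy_exp (2 * x - of_int m))"
    and "dy_pred (2 * x - of_int m) = 2 * dy_pred x - of_int m"
proof -
  show dy: "2 * x - of_int m \<in> dyadics"
    using dyadics_minus_of_int[OF dyadics_add[OF assms(1) assms(1)]] by simp
  have pos: "dy_exp x \<noteq> 0" using assms by (simp add: dy_exp_eq_0_iff)
  have "dy_exp (2 * x - of_int m) = dy_exp x - 1"
  proof (intro dy_exp_eqI dy)
    fix n
    have "(2 * x - of_int m) * 2 ^ n \<in> \<int> \<longleftrightarrow> x * 2 ^ Suc n \<in> \<int>"
      by (simp add: left_diff_distrib mult.assoc mult.left_commute[of x] mult.commute[of 2 x])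
    then show "(2 * x - of_int m) * 2 ^ n \<in> \<int> \<longleftrightarrow> dy_exp x - 1 \<le> n"
      using dy_exp_le_iff[OF assms(1), of "Suc n"] by auto
  qed
  with pos show e: "dy_exp x = Suc (dy_exp (2 * x - of_int m))" by simp
  then show "dy_pred (2 * x - of_int m) = 2 * dy_pred x - of_int m"
    by (simp add: dy_pred_def)
qed


section \<open>The levels and the sequences through a dyadic number\<close>

lemma dyV_Suc: "dyV (Suc p) = {dyU p k x | x k. x \<in> dyV p}"
  by (simp add: dyU_def)

declare dyV.simps(2) [simp del] dyS.simps(2) [simp del]

lemma dyU_0 [simp]: "dyU p 0 x = x"
  by (simp add: dyU_def)

lemma dyU_mono:
  assumes "x < dyS p x" "k \<le> l"
  shows "dyU p k x \<le> dyU p l x"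
  using assms by (auto simp: dyU_def intro!: divide_left_mono power_increasing)

lemma dyU_less_iff:
  assumes "x < dyS p x"
  shows "dyU p k x < dyU p l x \<longleftrightarrow> k < l"
proof -
  have "dyU p k x < dyU p l x" if "k < l" for k l
    using assms that by (auto simp: dyU_def intro!: divide_strict_left_mono power_strict_increasing)
  then show ?thesis
    using dyU_mono[OF assms] by (meson leD not_le)
qed

lemma dyU_less_dyS: "x < dyS p x \<Longrightarrow> dyU p k x < dyS p x"
  by (simp add: dyU_def)

lemma dyU_ge: "x < dyS p x \<Longrightarrow> x \<le> dyU p k x"
  using dyU_mono[of x p 0 k] by simp

text \<open>The intervals from a point of a level to its successor have pairwise disjoint interiors. This
  is what makes the descriptions of the next level definite.\<close>

definition dyS_separated :: "nat \<Rightarrow> bool" where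
  "dyS_separated p \<longleftrightarrow>
    (\<forall>x\<in>dyV p. x < dyS p x) \<and> (\<forall>x\<in>dyV p. \<forall>y\<in>dyV p. x < y \<longrightarrow> dyS p x \<le> y)"

lemma dyU_inject:
  assumes "dyS_separated p" "x \<in> dyV p" "y \<in> dyV p" "dyU p k x = dyU p l y"
  shows "x = y" "k = l"
proof -
  have x: "x < dyS p x" and y: "y < dyS p y"
    using assms unfolding dyS_separated_def by auto
  have "\<not> x < y"
    using assms dyU_less_dyS[OF x, of k] dyU_ge[OF y, of l] unfolding dyS_separated_def by force
  moreover have "\<not> y < x"
    using assms dyU_less_dyS[OF y, of l] dyU_ge[OF x, of k] unfolding dyS_separated_def by force
  ultimately show "x = y" by simp
  then show "k = l" using assms(4) dyU_less_iff[OF x] by (metis nat_neq_iff order_less_irrefl)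
qed

text \<open>Uniqueness of the representation of a point of the next level turns the definite description into
  a rewrite rule.\<close>

lemma dyS_dyU:
  assumes "dyS_separated p" "x \<in> dyV p"
  shows "dyS (Suc p) (dyU p k x) = dyU p (Suc k) x"
  unfolding dyS.simps(2)
proof (rule the_equality)
  fix w
  assume "\<exists>y l. y \<in> dyV p \<and> dyU p k x = dyS p y - (dyS p y - y) / 2 ^ l \<and>
     w = dyS p y - (dyS p y - y) / 2 ^ (l + 1)"
  then show "w = dyU p (Suc k) x"
    using dyU_inject[OF assms(1) assms(2)] unfolding dyU_def by force
qed (use assms in \<open>auto simp: dyU_def\<close>)

lemma dyS_separated: "dyS_separated p"
proof (induction p)
  case 0
  then show ?case by (auto simp: dyS_separated_def elim!: Ints_cases)
next
  case (Suc p)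
  note S = dyS_dyU[OF Suc]
  have lt: "x < dyS p x" if "x \<in> dyV p" for x using Suc that by (auto simp: dyS_separated_def)
  have "dyU p (Suc k) x \<le> dyU p l y"
    if "x \<in> dyV p" "y \<in> dyV p" "dyU p k x < dyU p l y" for x y k l
  proof (cases x y rule: linorder_cases)
    case less
    then have "dyS p x \<le> y" using Suc that by (auto simp: dyS_separated_def)
    then show ?thesis using dyU_less_dyS[OF lt, of x "Suc k"] dyU_ge[OF lt, of y l] that by simp
  next
    case equal
    then show ?thesis using that dyU_less_iff[OF lt, of x k l] dyU_mono[OF lt, of x "Suc k" l] by auto
  next
    case greater
    then have "dyS p y \<le> x" using Suc that by (auto simp: dyS_separated_def)
    then show ?thesis using dyU_less_dyS[OF lt, of y l] dyU_ge[OF lt, of x k] that by simp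
  qed
  then show ?case
    unfolding dyS_separated_def dyV_Suc using lt by (auto simp: S dyU_less_iff)
qed

lemmas dyS_dyU' = dyS_dyU[OF dyS_separated]

lemma dyV_mono: "x \<in> dyV p \<Longrightarrow> x \<in> dyV (Suc p)"
  unfolding dyV_Suc by (metis (mono_tags, lifting) dyU_0 mem_Collect_eq)

lemma dyU_in_dyV: "x \<in> dyV p \<Longrightarrow> dyU p k x \<in> dyV (Suc p)"
  by (auto simp: dyV_Suc)

lemma dyU_of_standard:
  assumes "x = of_int j / 2 ^ n" "dyS p x = of_int (j + 1) / 2 ^ n"
  shows "dyU p k x = of_int ((j + 1) * 2 ^ k - 1) / 2 ^ (n + k)"
  using assms(2) unfolding dyU_def by (simp add: assms(1) field_simps power_add)

lemma dyS_standard: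
  "x \<in> dyV p \<Longrightarrow> \<exists>n j. x = of_int j / 2 ^ n \<and> dyS p x = of_int (j + 1) / 2 ^ n"
proof (induction p arbitrary: x)
  case 0
  then obtain j where "x = of_int j" by (auto elim: Ints_cases)
  then show ?case by (intro exI[of _ 0] exI[of _ j]) simp
next
  case (Suc p)
  then obtain y k where x: "x = dyU p k y" and y: "y \<in> dyV p" by (auto simp: dyV_Suc)
  obtain n j where nj: "y = of_int j / 2 ^ n" "dyS p y = of_int (j + 1) / 2 ^ n"
    using Suc.IH[OF y] by blast
  let ?m = "(j + 1) * 2 ^ Suc k - 2"
  have "x = of_int ?m / 2 ^ (n + Suc k)"
    unfolding x dyU_of_standard[OF nj] by (simp add: power_add field_simps)
  moreover have "dyS (Suc p) x = of_int (?m + 1) / 2 ^ (n + Suc k)"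
    unfolding x dyS_dyU'[OF y] unfolding dyU_of_standard[OF nj] by simp
  ultimately show ?case by blast
qed

text \<open>If \<open>[j/2\<^sup>n, (j+1)/2\<^sup>n]\<close> is the interval from \<open>x\<close> to its successor, then \<open>dyU p k x\<close> is
  \<open>(j+1)/2\<^sup>n - 1/2\<^sup>n\<^sup>+\<^sup>k\<close>. For positive \<open>k\<close> its numerator over \<open>2\<^sup>n\<^sup>+\<^sup>k\<close> is odd, so the predecessor is
  \<open>1/2\<^sup>n\<^sup>+\<^sup>k\<close> below it.\<close>

lemma dy_pred_dyU:
  assumes "x \<in> dyV p"
  shows "dy_pred (dyU p (Suc k) x) = dyU p k x"
proof -
  obtain n j where nj: "x = of_int j / 2 ^ n" "dyS p x = of_int (j + 1) / 2 ^ n"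
    using dyS_standard[OF assms] by blast
  have "dy_pred (dyU p (Suc k) x) = of_int ((j + 1) * 2 ^ Suc k - 1 - 1) / 2 ^ (n + Suc k)"
    unfolding dyU_of_standard[OF nj] by (rule dy_pred_odd) simp
  also have "\<dots> = dyU p k x"
    unfolding dyU_of_standard[OF nj] by (simp add: power_add field_simps)
  finally show ?thesis .
qed

text \<open>A point \<open>dyU p k y\<close> with \<open>k \<ge> 1\<close> goes to \<open>dyU p (k - 1) y\<close>, which is its predecessor by
  \<open>dy_pred_dyU\<close>; on points of earlier levels the map is inherited.\<close>

lemma dyT_eq_dy_pred: "x \<in> dyV p \<Longrightarrow> dyT p x = dy_pred x"
proof (induction p)
  case 0
  then show ?case by (auto elim!: Ints_cases)
next
  case (Suc p)
  show ?case
  proof (cases "x \<in> dyV p")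
    case False
    obtain y k where x: "x = dyU p k y" and y: "y \<in> dyV p"
      using Suc.prems by (auto simp: dyV_Suc)
    have "k \<noteq> 0" using False x y by (metis dyU_0)
    then obtain l where k: "k = Suc l" using not0_implies_Suc by blast
    have "dyT (Suc p) x = dyU p l y"
      unfolding dyT.simps if_not_P[OF False]
    proof (rule the_equality)
      show "\<exists>z i. z \<in> dyV p \<and> 1 \<le> i \<and> x = dyU p i z \<and> dyU p l y = dyU p (i - 1) z"
        using x y k by (intro exI[of _ y] exI[of _ k]) simp
    next
      fix w
      assume "\<exists>z i. z \<in> dyV p \<and> 1 \<le> i \<and> x = dyU p i z \<and> w = dyU p (i - 1) z"
      then obtain z i where z: "z \<in> dyV p" "x = dyU p i z" "w = dyU p (i - 1) z" by blast
      then have "y = z" "k = i" using dyU_inject[OF dyS_separated y, of z k i] x by simp_all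
      then show "w = dyU p l y" using z(3) k by auto
    qed
    then show ?thesis using dy_pred_dyU[OF y] x k by simp
  qed (use Suc in simp)
qed

lemma dyS_dy_pred:
  assumes "x \<in> dyV p" "\<And>q. q < p \<Longrightarrow> x \<notin> dyV q"
  shows "dy_pred x \<in> dyV p" "dyS p (dy_pred x) = x"
proof -
  have "dy_pred x \<in> dyV p \<and> dyS p (dy_pred x) = x"
  proof (cases p)
    case 0
    then show ?thesis using assms by (auto elim!: Ints_cases)
  next
    case (Suc q)
    obtain y k where x: "x = dyU q k y" and y: "y \<in> dyV q"
      using assms(1) by (auto simp: dyV_Suc Suc)
    have "k \<noteq> 0" using assms(2)[of q] Suc x y by (metis dyU_0 lessI)
    then obtain l where "k = Suc l" using not0_implies_Suc by blast
    then show ?thesis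
      using dy_pred_dyU[OF y] dyS_dyU'[OF y] dyU_in_dyV[OF y] by (simp add: x Suc)
  qed
  then show "dy_pred x \<in> dyV p" "dyS p (dy_pred x) = x" by auto
qed

lemma dy_pred_in_dyV: "x \<in> dyV p \<Longrightarrow> dy_pred x \<in> dyV p"
proof (induction p)
  case 0
  then show ?case by (auto elim!: Ints_cases)
next
  case (Suc p)
  then obtain y k where x: "x = dyU p k y" and y: "y \<in> dyV p" by (auto simp: dyV_Suc)
  show ?case
  proof (cases k)
    case 0
    then show ?thesis using Suc.IH x y dyV_mono by simp
  next
    case (Suc l)
    then show ?thesis using x dy_pred_dyU[OF y] dyU_in_dyV[OF y] by simp
  qed
qed

text \<open>Halving a standard interval that ends where some level interval ends gives two intervals of
  the same kind, so every dyadic number occurs at some level.\<close>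

lemma standard_interval_in_level:
  "\<exists>p k y. y \<in> dyV p \<and> of_int j / 2 ^ n = dyU p k y \<and> of_int (j + 1) / 2 ^ n = dyS p y"
proof (induction n arbitrary: j)
  case 0
  show ?case by (intro exI[of _ 0] exI[of _ "of_int j"]) simp
next
  case (Suc n)
  obtain p k y where y: "y \<in> dyV p"
    and l: "real_of_int (j div 2) / 2 ^ n = dyU p k y"
    and r: "real_of_int (j div 2 + 1) / 2 ^ n = dyS p y"
    using Suc.IH by blast
  have mid: "dyU p (Suc k) y = of_int (2 * (j div 2) + 1) / 2 ^ Suc n"
  proof -
    have "dyU p (Suc k) y = (dyU p k y + dyS p y) / 2" by (simp add: dyU_def field_simps)
    then show ?thesis by (simp add: field_simps flip: l r)
  qed
  show ?case
  proof (cases "even j")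
    case True
    then have j: "j = 2 * (j div 2)" by simp
    have "real_of_int j / 2 ^ Suc n = dyU p k y" using l j by (simp add: field_simps)
    moreover have "real_of_int (j + 1) / 2 ^ Suc n = dyU p (Suc k) y" using mid j by simp
    ultimately show ?thesis
      using dyU_in_dyV[OF y, of k] dyS_dyU'[OF y, of k]
      by (intro exI[of _ "Suc p"] exI[of _ 0] exI[of _ "dyU p k y"]) simp
  next
    case False
    then have j: "j = 2 * (j div 2) + 1" by simp
    then have "j + 1 = 2 * (j div 2 + 1)" by simp
    then have "real_of_int (j + 1) = 2 * of_int (j div 2 + 1)" by (metis of_int_mult of_int_numeral)
    then have "real_of_int (j + 1) / 2 ^ Suc n = dyS p y" using r by (simp add: field_simps)
    moreover have "real_of_int j / 2 ^ Suc n = dyU p (Suc k) y" using mid j by simp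
    ultimately show ?thesis using y by blast
  qed
qed

text \<open>The least level exists because every dyadic number is an endpoint of a standard interval.\<close>

lemma dy_level:
  assumes "x \<in> dyadics"
  shows "x \<in> dyV (dy_level x)" "q < dy_level x \<Longrightarrow> x \<notin> dyV q"
proof -
  obtain j n where "x = of_int j / 2 ^ n" using assms by (auto simp: dyadics_def)
  then have "\<exists>p. x \<in> dyV p" using standard_interval_in_level[of j n] dyU_in_dyV by metis
  then show "x \<in> dyV (dy_level x)" unfolding dy_level_def by (rule LeastI_ex)
  show "q < dy_level x \<Longrightarrow> x \<notin> dyV q" unfolding dy_level_def by (rule not_less_Least)
qed

lemma dy_seq_nonneg:
  assumes "x \<in> dyadics"
  shows "dy_seq x (int k) = x - (x - dy_pred x) / 2 ^ k"
proof -
  let ?p = "dy_level x"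
  note V = dy_level[OF assms]
  note P = dyS_dy_pred[OF V]
  have "(dyS (Suc ?p) ^^ k) (dy_pred x) = dyU ?p k (dy_pred x)"
    by (induction k) (simp_all add: dyS_dyU' P)
  then show ?thesis
    by (simp add: dy_seq_def Let_def dyT_eq_dy_pred V dyU_def P)
qed

lemma dy_seq_neg:
  assumes "x \<in> dyadics"
  shows "dy_seq x (- int k) = (dy_pred ^^ Suc k) x"
proof -
  let ?p = "dy_level x"
  note V = dy_level[OF assms]
  note P = dyS_dy_pred[OF V]
  have "(dyT ?p ^^ k) (dy_pred x) = (dy_pred ^^ Suc k) x \<and> (dy_pred ^^ Suc k) x \<in> dyV ?p"
    by (induction k) (simp_all add: dyT_eq_dy_pred dy_pred_in_dyV P)
  then show ?thesis
    using dy_seq_nonneg[OF assms, of 0]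
    by (cases k) (simp_all add: dy_seq_def Let_def dyT_eq_dy_pred V nat_add_distrib)
qed


section \<open>Linear pieces and increasing bijections of the line\<close>

lemma linear_ontoI:
  assumes "\<And>t. a \<le> t \<Longrightarrow> t \<le> b \<Longrightarrow> f t = c + s * (t - a)" "a < b" "d = c + s * (b - a)"
  shows "linear_onto f a b c d"
  using assms by (auto simp: linear_onto_def)

lemma linear_onto_subinterval:
  assumes "linear_onto f a b c d" "a \<le> a'" "a' < b'" "b' \<le> b"
  shows "linear_onto f a' b' (f a') (f b')"
proof -
  define s where "s = (d - c) / (b - a)"
  have f: "f t = c + s * (t - a)" if "a \<le> t" "t \<le> b" for t
    using assms(1) that by (simp add: linear_onto_def s_def)
  show ?thesis
    by (rule linear_ontoI[where s = s]) (use assms(2-4) in \<open>auto simp: f algebra_simps\<close>)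
qed

lemma linear_onto_backwards:
  assumes "linear_onto f a b (f a) (f b)" "a < b" "0 \<le> s" "s \<le> 1"
  shows "f (b - (b - a) * s) = f b - (f b - f a) * s"
proof -
  have "0 \<le> (b - a) * s" using assms(2,3) by simp
  moreover have "(b - a) * s \<le> b - a" using assms(2-4) mult_left_le[of s "b - a"] by linarith
  ultimately have "b - (b - a) * s \<in> {a..b}" unfolding atLeastAtMost_iff by linarith
  then have "f (b - (b - a) * s) = f a + (f b - f a) / (b - a) * (b - (b - a) * s - a)"
    using assms(1) unfolding linear_onto_def by blast
  also have "b - (b - a) * s - a = (b - a) * (1 - s)" by (simp add: algebra_simps)
  also have "f a + (f b - f a) / (b - a) * ((b - a) * (1 - s)) = f b - (f b - f a) * s"
  proof -
    have "(f b - f a) / (b - a) * ((b - a) * (1 - s)) = (f b - f a) * (1 - s)" using assms(2) by simp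
    then show ?thesis by (simp add: algebra_simps)
  qed
  finally show ?thesis .
qed

lemma linear_onto_image:
  assumes "linear_onto f a b c d" "a < b" "c < d" "t \<in> {a..b}"
  shows "f t \<in> {c..d}"
proof -
  have "0 \<le> (t - a) / (b - a)" "(t - a) / (b - a) \<le> 1" using assms by auto
  then have "0 \<le> (d - c) * ((t - a) / (b - a))" "(d - c) * ((t - a) / (b - a)) \<le> (d - c) * 1"
    using assms(3) by (intro mult_nonneg_nonneg mult_left_mono; simp)+
  then show ?thesis using assms by (auto simp: linear_onto_def)
qed

lemma linear_onto_comp:
  assumes "linear_onto f a b c d" "linear_onto g c d e k" "a < b" "c < d"
  shows "linear_onto (g \<circ> f) a b e k"
  unfolding linear_onto_def
proof
  fix t assume t: "t \<in> {a..b}"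
  then have "g (f t) = e + (k - e) / (d - c) * (f t - c)"
    using assms(2) linear_onto_image[OF assms(1,3,4)] by (simp add: linear_onto_def)
  also have "f t - c = (d - c) * ((t - a) / (b - a))"
    using assms(1) t by (simp add: linear_onto_def)
  finally show "(g \<circ> f) t = e + (k - e) / (b - a) * (t - a)"
    using assms(4) by simp
qed

abbreviation finv :: "(real \<Rightarrow> real) \<Rightarrow> real \<Rightarrow> real" where
  "finv f \<equiv> inv_into UNIV f"

lemma linear_onto_finv:
  assumes "linear_onto f a b c d" "inj f" "a < b" "c < d"
  shows "linear_onto (finv f) c d a b"
  unfolding linear_onto_def
proof
  fix t assume t: "t \<in> {c..d}"
  let ?s = "a + (b - a) / (d - c) * (t - c)"
  have "(t - c) / (d - c) \<le> 1" "0 \<le> (t - c) / (d - c)" using t assms by auto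
  then have "0 \<le> (b - a) * ((t - c) / (d - c))" "(b - a) * ((t - c) / (d - c)) \<le> (b - a) * 1"
    using assms(3) by (intro mult_nonneg_nonneg mult_left_mono; simp)+
  then have "?s \<in> {a..b}" by simp
  then have "f ?s = t" using assms by (simp add: linear_onto_def)
  then show "finv f t = ?s" using assms(2) by (metis inv_f_f)
qed

text \<open>Increasing bijections of the real line are homeomorphisms; continuity is derived from
  monotonicity only where the definition of \<open>F\<close> asks for it.\<close>

definition line_homeo :: "(real \<Rightarrow> real) \<Rightarrow> bool" where
  "line_homeo f \<longleftrightarrow> strict_mono f \<and> surj f"

lemma line_homeo_bij: "line_homeo f \<Longrightarrow> bij f"
  by (auto simp: line_homeo_def bij_def strict_mono_imp_inj_on)

lemma line_homeo_inj: "line_homeo f \<Longrightarrow> inj f"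
  by (simp add: bij_is_inj line_homeo_bij)

lemma line_homeo_less [simp]: "line_homeo f \<Longrightarrow> f a < f b \<longleftrightarrow> a < b"
  by (simp add: line_homeo_def strict_mono_less)

lemma line_homeo_le [simp]: "line_homeo f \<Longrightarrow> f a \<le> f b \<longleftrightarrow> a \<le> b"
  by (simp add: line_homeo_def strict_mono_less_eq)

lemma line_homeo_f_finv [simp]: "line_homeo f \<Longrightarrow> f (finv f t) = t"
  by (simp add: line_homeo_def surj_f_inv_f)

lemma line_homeo_finv_f [simp]: "line_homeo f \<Longrightarrow> finv f (f t) = t"
  by (simp add: line_homeo_inj)

lemma line_homeo_comp: "line_homeo f \<Longrightarrow> line_homeo g \<Longrightarrow> line_homeo (f \<circ> g)"
  by (simp only: line_homeo_def comp_surj strict_mono_o)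

lemma line_homeo_finv: "line_homeo f \<Longrightarrow> line_homeo (finv f)"
  unfolding line_homeo_def[of "finv f"] strict_mono_def
  by (metis line_homeo_bij bij_imp_bij_inv bij_is_surj line_homeo_f_finv line_homeo_less)

lemma line_homeo_finv_finv: "line_homeo f \<Longrightarrow> finv (finv f) = f"
  by (simp add: inv_inv_eq line_homeo_bij)

lemma line_homeo_id: "line_homeo id"
  by (auto simp: line_homeo_def strict_mono_def)

lemma line_homeo_translation: "line_homeo (\<lambda>t. t - c)"
  unfolding line_homeo_def strict_mono_def by (auto simp: surj_def intro: exI[of _ "_ + c"])


section \<open>The maps of the vertices and their conjugates\<close>

text \<open>Each gap of the sequence lies between some dyadic \<open>z\<close> and its predecessor: \<open>z\<close> is \<open>x\<close> itself for
  nonnegative indices and an iterated predecessor of \<open>x\<close> for negative ones. A map that is linear on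
  all intervals from a predecessor is therefore linear on every gap.\<close>

lemma dy_seq_step:
  assumes "x \<in> dyadics"
  obtains z where "z \<in> dyadics" "z \<le> x" "dy_pred z \<le> dy_seq x k" "dy_seq x k < dy_seq x (k + 1)"
    "dy_seq x (k + 1) \<le> z"
proof (cases "0 \<le> k")
  case True
  then obtain n where k: "k = int n" using nonneg_int_cases by blast
  have k1: "k + 1 = int (Suc n)" by (simp add: k)
  define d where "d = x - dy_pred x"
  have d: "d > 0" by (simp add: d_def)
  have "dy_pred x \<le> dy_seq x k"
  proof -
    have "d / 2 ^ n \<le> d / 1" using d by (intro divide_left_mono) auto
    then show ?thesis unfolding k dy_seq_nonneg[OF assms] by (simp add: d_def)
  qed
  moreover have "dy_seq x k < dy_seq x (k + 1)"
    using d unfolding k1 dy_seq_nonneg[OF assms] unfolding k dy_seq_nonneg[OF assms]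
    by (simp add: field_simps flip: d_def)
  moreover have "dy_seq x (k + 1) \<le> x"
    using d unfolding k1 dy_seq_nonneg[OF assms] by (simp flip: d_def)
  ultimately show ?thesis using that[of x] assms by blast
next
  case False
  then obtain n where k: "k = - int (Suc n)" by (meson negD not_le)
  have k1: "k + 1 = - int n" by (simp add: k)
  have n: "(dy_pred ^^ i) x \<le> x" for i
  proof -
    have "0 \<le> real i / 2 ^ dy_exp x" by simp
    then show ?thesis using funpow_dy_pred_le[OF assms, of i] by linarith
  qed
  have z: "(dy_pred ^^ Suc n) x \<in> dyadics" using assms by (rule dyadics_funpow_dy_pred)
  have seq: "dy_seq x k = dy_pred ((dy_pred ^^ Suc n) x)" "dy_seq x (k + 1) = (dy_pred ^^ Suc n) x"
    unfolding k1 dy_seq_neg[OF assms] unfolding k dy_seq_neg[OF assms] by simp_all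
  show ?thesis by (rule that[OF z n]) (simp_all add: seq del: funpow.simps)
qed

lemma dy_seq_cover:
  assumes "x \<in> dyadics" "t < x"
  obtains k where "dy_seq x k \<le> t" "t \<le> dy_seq x (k + 1)"
proof (cases "dy_pred x \<le> t")
  case True
  define d where "d = x - dy_pred x"
  have d: "d > 0" by (simp add: d_def)
  obtain n where "(1/2) ^ n < (x - t) / d"
    using real_arch_pow_inv[of "(x - t) / d" "1/2"] d assms by auto
  then have ex: "t < x - d / 2 ^ n" using d by (simp add: field_simps power_divide)
  define m where "m = (LEAST n. t < x - d / 2 ^ n)"
  have m: "t < x - d / 2 ^ m" unfolding m_def using ex by (rule LeastI)
  then have "m \<noteq> 0" by (intro notI) (use True in \<open>simp add: d_def\<close>)
  then obtain l where l: "m = Suc l" using not0_implies_Suc by blast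
  then have "\<not> t < x - d / 2 ^ l" unfolding m_def by (metis lessI not_less_Least)
  moreover have "int l + 1 = int m" using l by simp
  ultimately show ?thesis
    using that[of "int l"] m dy_seq_nonneg[OF assms(1), of l] dy_seq_nonneg[OF assms(1), of m]
    by (simp flip: d_def)
next
  case False
  obtain i where i: "(dy_pred ^^ i) x \<le> t" using funpow_dy_pred_unbounded[OF assms(1)] by blast
  define m where "m = (LEAST i. (dy_pred ^^ i) x \<le> t)"
  have m: "(dy_pred ^^ m) x \<le> t" unfolding m_def using i by (rule LeastI)
  have "m \<noteq> 0" using m assms(2) by (intro notI) simp
  moreover have "m \<noteq> 1" using m False by (intro notI) simp
  ultimately obtain l where l: "m = Suc (Suc l)" by (metis One_nat_def not0_implies_Suc)
  then have "\<not> (dy_pred ^^ Suc l) x \<le> t" unfolding m_def by (metis lessI not_less_Least)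
  moreover have "- int (Suc l) + 1 = - int l" by simp
  ultimately show ?thesis
    using that[of "- int (Suc l)"] m[unfolded l]
      dy_seq_neg[OF assms(1), of l] dy_seq_neg[OF assms(1), of "Suc l"]
    by simp
qed

text \<open>The predicate inside the definite description of \<open>dy_homeo x\<close>, named because it will be transported
  along conjugations.\<close>

definition dy_shift :: "(real \<Rightarrow> real) \<Rightarrow> real \<Rightarrow> bool" where
  "dy_shift f x \<longleftrightarrow>
    (\<forall>k. linear_onto f (dy_seq x k) (dy_seq x (k + 1)) (dy_seq x (k - 1)) (dy_seq x k)) \<and>
    (\<forall>t\<ge>x. f t = t)"

lemma dy_shift_unique:
  assumes "x \<in> dyadics" "dy_shift f x" "dy_shift g x"
  shows "f = g"
proof
  fix t
  show "f t = g t"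
  proof (cases "t < x")
    case True
    then obtain k where "dy_seq x k \<le> t" "t \<le> dy_seq x (k + 1)"
      using dy_seq_cover assms(1) by blast
    then have t: "t \<in> {dy_seq x k..dy_seq x (k + 1)}" by simp
    have lin: "linear_onto f (dy_seq x k) (dy_seq x (k + 1)) (dy_seq x (k - 1)) (dy_seq x k)"
      "linear_onto g (dy_seq x k) (dy_seq x (k + 1)) (dy_seq x (k - 1)) (dy_seq x k)"
      using assms unfolding dy_shift_def by blast+
    show ?thesis
      using lin[unfolded linear_onto_def] t by simp
  qed (use assms in \<open>auto simp: dy_shift_def\<close>)
qed

lemma dy_homeo_eqI: "x \<in> dyadics \<Longrightarrow> dy_shift f x \<Longrightarrow> dy_homeo x = f"
  unfolding dy_homeo_def dy_shift_def[symmetric]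
  by (rule the_equality) (auto intro: dy_shift_unique)

text \<open>The structure on \<open>(-\<infinity>, x)\<close> that determines the sequences of all dyadic points in it.\<close>

definition preserves_dy_pred :: "(real \<Rightarrow> real) \<Rightarrow> real \<Rightarrow> bool" where
  "preserves_dy_pred f x \<longleftrightarrow> (\<forall>y\<in>dyadics. y < x \<longrightarrow>
     dy_pred (f y) = f (dy_pred y) \<and> linear_onto f (dy_pred y) y (f (dy_pred y)) (f y))"

definition preserves_dyadics :: "(real \<Rightarrow> real) \<Rightarrow> bool" where
  "preserves_dyadics f \<longleftrightarrow> (\<forall>y. f y \<in> dyadics \<longleftrightarrow> y \<in> dyadics)"

lemma preserves_dyadics_comp:
  "preserves_dyadics f \<Longrightarrow> preserves_dyadics g \<Longrightarrow> preserves_dyadics (f \<circ> g)"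
  by (simp add: preserves_dyadics_def)

lemma preserves_dyadics_finv:
  "line_homeo f \<Longrightarrow> preserves_dyadics f \<Longrightarrow> preserves_dyadics (finv f)"
  unfolding preserves_dyadics_def by (metis line_homeo_f_finv)

lemma preserves_dy_pred_mono:
  "preserves_dy_pred f x \<Longrightarrow> y \<le> x \<Longrightarrow> preserves_dy_pred f y"
  by (auto simp: preserves_dy_pred_def)

lemma preserves_dy_pred_comp:
  assumes "preserves_dy_pred f x" "preserves_dy_pred g (f x)" "line_homeo f" "preserves_dyadics f"
  shows "preserves_dy_pred (g \<circ> f) x"
  unfolding preserves_dy_pred_def
proof (intro ballI impI conjI)
  fix y assume y: "y \<in> dyadics" "y < x"
  have f: "dy_pred (f y) = f (dy_pred y)" "linear_onto f (dy_pred y) y (f (dy_pred y)) (f y)"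
    using assms(1) y by (auto simp: preserves_dy_pred_def)
  have "f y \<in> dyadics" "f y < f x" using assms(3,4) y by (auto simp: preserves_dyadics_def)
  then have g: "dy_pred (g (f y)) = g (dy_pred (f y))"
    "linear_onto g (dy_pred (f y)) (f y) (g (dy_pred (f y))) (g (f y))"
    using assms(2) by (auto simp: preserves_dy_pred_def)
  show "dy_pred ((g \<circ> f) y) = (g \<circ> f) (dy_pred y)" using f g by simp
  show "linear_onto (g \<circ> f) (dy_pred y) y ((g \<circ> f) (dy_pred y)) ((g \<circ> f) y)"
    using linear_onto_comp[OF f(2)] g f assms(3) by simp
qed

lemma preserves_dy_pred_finv:
  assumes "preserves_dy_pred f x" "line_homeo f" "preserves_dyadics f"
  shows "preserves_dy_pred (finv f) (f x)"
  unfolding preserves_dy_pred_def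
proof (intro ballI impI)
  fix y assume y: "y \<in> dyadics" "y < f x"
  define z where "z = finv f y"
  have yz: "y = f z" using assms(2) by (simp add: z_def)
  have z: "z \<in> dyadics" "z < x" using y assms unfolding yz by (auto simp: preserves_dyadics_def)
  then have f: "dy_pred (f z) = f (dy_pred z)" "linear_onto f (dy_pred z) z (f (dy_pred z)) (f z)"
    using assms(1) by (auto simp: preserves_dy_pred_def)
  show "dy_pred (finv f y) = finv f (dy_pred y) \<and>
      linear_onto (finv f) (dy_pred y) y (finv f (dy_pred y)) (finv f y)"
    unfolding yz f(1)
    using linear_onto_finv[OF f(2) line_homeo_inj] assms(2) by simp
qed

text \<open>To the left the sequence consists of predecessors, which \<open>f\<close> respects; to the right it consists of
  points dividing the interval from the predecessor of \<open>y\<close> to \<open>y\<close> in fixed ratios, which are respected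
  because \<open>f\<close> is linear there.\<close>

lemma preserves_dy_pred_dy_seq:
  assumes "preserves_dy_pred f x" "preserves_dyadics f" "y \<in> dyadics" "y < x"
  shows "f (dy_seq y k) = dy_seq (f y) k"
proof -
  have fy: "f y \<in> dyadics" using assms by (auto simp: preserves_dyadics_def)
  show ?thesis
  proof (cases k rule: int_cases2)
    case (nonneg n)
    have "dy_seq y k = y - (y - dy_pred y) * (1 / 2 ^ n)"
      using dy_seq_nonneg[OF assms(3)] nonneg by simp
    also have "f \<dots> = f y - (f y - f (dy_pred y)) * (1 / 2 ^ n)"
      using assms by (intro linear_onto_backwards) (auto simp: preserves_dy_pred_def)
    also have "\<dots> = dy_seq (f y) k"
      using assms dy_seq_nonneg[OF fy] nonneg by (simp add: preserves_dy_pred_def)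
    finally show ?thesis .
  next
    case (nonpos n)
    have "f ((dy_pred ^^ i) y) = (dy_pred ^^ i) (f y) \<and> (dy_pred ^^ i) y < x" for i
    proof (induction i)
      case (Suc i)
      then show ?case
        using assms dyadics_funpow_dy_pred[OF assms(3), of i] less_trans[OF dy_pred_less]
        by (auto simp: preserves_dy_pred_def)
    qed (use assms in simp)
    then show ?thesis
      unfolding nonpos dy_seq_neg[OF fy] dy_seq_neg[OF assms(3)] by (rule conjunct1)
  qed
qed

text \<open>On each gap of the image sequence the conjugate is a composition of three linear maps: back to the
  sequence of \<open>y\<close>, one step down along it, and forward again.\<close>

lemma dy_shift_conj:
  assumes "preserves_dy_pred f x" "preserves_dyadics f" "line_homeo f"
    and "y \<in> dyadics" "y < x" "dy_shift h y"
  shows "dy_shift (f \<circ> h \<circ> finv f) (f y)"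
  unfolding dy_shift_def
proof (intro conjI allI impI)
  fix t assume "f y \<le> t"
  then have "f y \<le> f (finv f t)" using assms(3) by simp
  then have "y \<le> finv f t" using assms(3) by (simp only: line_homeo_le)
  then show "(f \<circ> h \<circ> finv f) t = t" using assms by (simp add: dy_shift_def)
next
  fix k
  note seq = preserves_dy_pred_dy_seq[OF assms(1,2,4,5), symmetric]
  have step: "dy_seq y k < dy_seq y (k + 1) \<and>
      linear_onto f (dy_seq y k) (dy_seq y (k + 1)) (f (dy_seq y k)) (f (dy_seq y (k + 1)))" for k
  proof -
    obtain z where z: "z \<in> dyadics" "z \<le> y" "dy_pred z \<le> dy_seq y k"
      "dy_seq y k < dy_seq y (k + 1)" "dy_seq y (k + 1) \<le> z"
      using dy_seq_step[OF assms(4)] by blast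
    then have "linear_onto f (dy_pred z) z (f (dy_pred z)) (f z)"
      using assms by (auto simp: preserves_dy_pred_def)
    then show ?thesis using linear_onto_subinterval z by blast
  qed
  have 1: "linear_onto (finv f) (f (dy_seq y k)) (f (dy_seq y (k + 1))) (dy_seq y k) (dy_seq y (k + 1))"
    using step[of k] assms(3) by (intro linear_onto_finv line_homeo_inj) auto
  have 2: "linear_onto h (dy_seq y k) (dy_seq y (k + 1)) (dy_seq y (k - 1)) (dy_seq y k)"
    using assms(6) by (simp add: dy_shift_def)
  have 3: "linear_onto f (dy_seq y (k - 1)) (dy_seq y k) (f (dy_seq y (k - 1))) (f (dy_seq y k))"
    using step[of "k - 1"] by simp
  have lt: "f (dy_seq y k) < f (dy_seq y (k + 1))" "dy_seq y k < dy_seq y (k + 1)"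
    "dy_seq y (k - 1) < dy_seq y k"
    using step[of k] step[of "k - 1"] assms(3) by auto
  show "linear_onto (f \<circ> h \<circ> finv f) (dy_seq (f y) k) (dy_seq (f y) (k + 1))
      (dy_seq (f y) (k - 1)) (dy_seq (f y) k)"
    unfolding seq
    using linear_onto_comp[OF 1 linear_onto_comp[OF 2 3 lt(2,3)] lt(1,2)] by (simp add: comp_assoc)
qed


section \<open>Reduction to integer points\<close>

text \<open>The map \<open>h\<^sub>m\<close> for an integer \<open>m\<close>, see \<open>dy_homeo_of_int\<close> below.\<close>

definition int_shift :: "int \<Rightarrow> real \<Rightarrow> real" where
  "int_shift m t = (if t \<le> of_int m - 1 then t - 1 else if t \<le> of_int m then 2 * t - of_int m else t)"

lemma int_shift_left: "t \<le> of_int m - 1 \<Longrightarrow> int_shift m t = t - 1"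
  and int_shift_middle: "of_int m - 1 \<le> t \<Longrightarrow> t \<le> of_int m \<Longrightarrow> int_shift m t = 2 * t - of_int m"
  and int_shift_right: "of_int m \<le> t \<Longrightarrow> int_shift m t = t"
  by (auto simp: int_shift_def)

lemma line_homeo_int_shift: "line_homeo (int_shift m)"
  unfolding line_homeo_def
proof
  show "strict_mono (int_shift m)" by (auto simp: strict_mono_def int_shift_def)
  have "int_shift m (if t \<le> of_int m - 2 then t + 1 else if t \<le> of_int m then (t + of_int m) / 2 else t) = t" for t
    by (auto simp: int_shift_def field_simps)
  then show "surj (int_shift m)" by (rule surjI)
qed

lemma dyadics_half_iff: "2 * x - of_int m \<in> dyadics \<longleftrightarrow> x \<in> dyadics"
proof
  assume "2 * x - of_int m \<in> dyadics"
  then obtain n where "(2 * x - of_int m) * 2 ^ n \<in> \<int>" by (auto simp: dyadics_iff)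
  then have "x * 2 ^ Suc n \<in> \<int>"
    by (simp add: left_diff_distrib mult.assoc mult.left_commute[of x] mult.commute[of 2 x])
  then show "x \<in> dyadics" by (rule dyadicsI)
next
  assume "x \<in> dyadics"
  then show "2 * x - of_int m \<in> dyadics"
    using dyadics_minus_of_int[OF dyadics_add[of x x]] by simp
qed

lemma dyadics_minus_1_iff [simp]: "x - 1 \<in> dyadics \<longleftrightarrow> x \<in> dyadics"
  using dyadics_minus_of_int[of x 1] dyadics_minus_of_int[of "x - 1" "-1"] by auto

lemma preserves_dyadics_int_shift: "preserves_dyadics (int_shift m)"
  by (auto simp: preserves_dyadics_def int_shift_def dyadics_half_iff)

lemma preserves_dy_pred_translation: "preserves_dy_pred (\<lambda>t. t - 1) x"
  unfolding preserves_dy_pred_def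
proof (intro ballI impI conjI)
  fix y :: real assume "y \<in> dyadics"
  then show "dy_pred (y - 1) = dy_pred y - 1" using dy_pred_minus_of_int[of y 1] by simp
  show "linear_onto (\<lambda>t. t - 1) (dy_pred y) y (dy_pred y - 1) (y - 1)"
    by (rule linear_ontoI[where s = 1]) auto
qed

lemma preserves_dy_pred_int_shift: "preserves_dy_pred (int_shift m) (of_int m)"
  unfolding preserves_dy_pred_def
proof (intro ballI impI)
  fix y :: real assume y: "y \<in> dyadics" "y < of_int m"
  show "dy_pred (int_shift m y) = int_shift m (dy_pred y) \<and>
      linear_onto (int_shift m) (dy_pred y) y (int_shift m (dy_pred y)) (int_shift m y)"
  proof (cases "y \<le> of_int m - 1")
    case True
    have f: "int_shift m t = t - 1" if "t \<le> y" for t using True that by (intro int_shift_left) simp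
    have p: "dy_pred y \<le> y" by (rule less_imp_le) simp
    have "dy_pred (y - 1) = dy_pred y - 1" using dy_pred_minus_of_int[of y 1] y by simp
    moreover have "linear_onto (int_shift m) (dy_pred y) y (dy_pred y - 1) (y - 1)"
      by (rule linear_ontoI[where s = 1]) (auto simp: f)
    ultimately show ?thesis using p by (simp add: f)
  next
    case False
    then have lo: "of_int (m - 1) \<le> dy_pred y" using y by (intro of_int_le_dy_pred) auto
    have "y \<notin> \<int>"
    proof
      assume "y \<in> \<int>"
      then obtain j where "y = of_int j" by (auto elim: Ints_cases)
      with False y(2) show False by simp
    qed
    note d = dy_double[OF y(1) this]
    have f: "int_shift m t = 2 * t - of_int m" if "t \<le> y" "dy_pred y \<le> t" for t
      using that lo y(2) by (intro int_shift_middle) auto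
    have p: "dy_pred y \<le> y" by (rule less_imp_le) simp
    have "linear_onto (int_shift m) (dy_pred y) y (2 * dy_pred y - of_int m) (2 * y - of_int m)"
      by (rule linear_ontoI[where s = 2]) (auto simp: f)
    then show ?thesis using p by (simp add: f d)
  qed
qed

lemma funpow_dy_pred_of_int: "(dy_pred ^^ n) (of_int j) = of_int (j - int n)"
proof (induction n)
  case (Suc n)
  have "(dy_pred ^^ Suc n) (of_int j) = dy_pred (of_int (j - int n))" using Suc by simp
  then show ?case by (simp only: dy_pred_of_int)
qed simp

lemma dy_shift_int_shift: "dy_shift (int_shift m) (of_int m)"
  unfolding dy_shift_def
proof (intro conjI allI impI)
  fix t :: real assume "of_int m \<le> t"
  then show "int_shift m t = t" by (rule int_shift_right)
next
  fix k :: int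
  have nonneg: "dy_seq (of_int m) (int n) = of_int m - 1 / 2 ^ n" for n
    using dy_seq_nonneg[of "of_int m" n] by simp
  have neg: "dy_seq (of_int m) (- int n) = of_int m - 1 - of_int (int n)" for n
    using dy_seq_neg[of "of_int m" n] unfolding funpow_dy_pred_of_int by simp
  consider n where "k = int (Suc n)" | "k = 0" | n where "k = - int (Suc n)"
    by (metis int_cases negD neg_0_equal_iff_equal not0_implies_Suc of_nat_0 linorder_not_less)
  then show "linear_onto (int_shift m) (dy_seq (of_int m) k) (dy_seq (of_int m) (k + 1))
      (dy_seq (of_int m) (k - 1)) (dy_seq (of_int m) k)"
  proof cases
    case (1 n)
    then have k: "k - 1 = int n" "k = int (Suc n)" "k + 1 = int (Suc (Suc n))" by auto
    have le: "(1 :: real) / 2 ^ Suc n \<le> 1" using one_le_power[of "2::real" "Suc n"] by (simp add: divide_le_eq_1)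
    show ?thesis
      unfolding k(1,3) unfolding k(2) nonneg
    proof (rule linear_ontoI[where s = 2])
      fix t :: real
      assume t: "of_int m - 1 / 2 ^ Suc n \<le> t" "t \<le> of_int m - 1 / 2 ^ Suc (Suc n)"
      have "(0::real) \<le> 1 / 2 ^ Suc (Suc n)" by simp
      then have "int_shift m t = 2 * t - of_int m" using t le by (intro int_shift_middle) linarith+
      then show "int_shift m t = of_int m - 1 / 2 ^ n + 2 * (t - (of_int m - 1 / 2 ^ Suc n))"
        by (simp add: right_diff_distrib)
    qed (auto simp: field_simps)
  next
    case 2
    then have k: "k - 1 = - int 1" "k = int 0" "k + 1 = int (Suc 0)" by auto
    show ?thesis
      unfolding k(1,3) unfolding k(2) nonneg neg
      by (rule linear_ontoI[where s = 2]) (auto simp: int_shift_middle)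
  next
    case (3 n)
    then have k: "k - 1 = - int (Suc (Suc n))" "k = - int (Suc n)" "k + 1 = - int n" by auto
    show ?thesis
      unfolding k(1,3) unfolding k(2) neg
      by (rule linear_ontoI[where s = 1]) (auto simp: int_shift_left)
  qed
qed

text \<open>The map \<open>int_shift m\<close> doubles the distance to \<open>m\<close> on the unit interval below \<open>m\<close>, so iterating it with
  suitable \<open>m\<close> leads from any dyadic number to an integer.\<close>

lemma dyadic_induct [consumes 1, case_names int step]:
  assumes "x \<in> dyadics"
    and int: "\<And>m. P (of_int m)"
    and step: "\<And>x m. x \<in> dyadics \<Longrightarrow> of_int m - 1 < x \<Longrightarrow> x < of_int m \<Longrightarrow>
      P (int_shift m x) \<Longrightarrow> P x"
  shows "P x"
  using assms(1)
proof (induction "dy_exp x" arbitrary: x rule: less_induct)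
  case less
  show ?case
  proof (cases "x \<in> \<int>")
    case True
    then show ?thesis using int by (auto elim: Ints_cases)
  next
    case False
    define m where "m = \<lfloor>x\<rfloor> + 1"
    have "of_int \<lfloor>x\<rfloor> \<noteq> x" using False by (metis Ints_of_int)
    then have "of_int \<lfloor>x\<rfloor> < x" using of_int_floor_le[of x] by linarith
    then have m: "of_int m - 1 < x" "x < of_int m" unfolding m_def by linarith+
    have "int_shift m x = 2 * x - of_int m" using m by (intro int_shift_middle) auto
    then have "P (int_shift m x)"
      using less(1)[of "2 * x - of_int m"] dy_double[OF less(2) False, of m] by simp
    then show ?thesis using step less(2) m by blast
  qed
qed

lemma dyadics_int_shift [simp]: "int_shift m x \<in> dyadics \<longleftrightarrow> x \<in> dyadics"
  using preserves_dyadics_int_shift by (simp add: preserves_dyadics_def)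

text \<open>This is \<open>dy_shift_conj\<close> for the inverse of \<open>int_shift m\<close>, which preserves predecessors below \<open>m\<close>
  because \<open>int_shift m\<close> does so and fixes \<open>m\<close>.\<close>

lemma finv_int_shift_conj:
  assumes "x \<in> dyadics" "x < of_int m" "dy_shift h (int_shift m x)"
  shows "dy_shift (finv (int_shift m) \<circ> h \<circ> int_shift m) x"
proof -
  note L = line_homeo_int_shift[of m]
  have m: "int_shift m (of_int m) = of_int m" by (simp add: int_shift_right)
  have "int_shift m x < int_shift m (of_int m)" using L assms by simp
  then have "dy_shift (finv (int_shift m) \<circ> h \<circ> finv (finv (int_shift m)))
      (finv (int_shift m) (int_shift m x))"
    using assms L
    by (intro dy_shift_conj[OF preserves_dy_pred_finv[OF preserves_dy_pred_int_shift L]]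
        preserves_dyadics_int_shift preserves_dyadics_finv line_homeo_finv) simp_all
  then show ?thesis using L by (simp add: line_homeo_finv_finv)
qed

lemma dy_shift_exists: "x \<in> dyadics \<Longrightarrow> \<exists>f. dy_shift f x"
proof (induction rule: dyadic_induct)
  case (int m)
  then show ?case using dy_shift_int_shift by blast
next
  case (step x m)
  then show ?case using finv_int_shift_conj by blast
qed

lemma dy_shift_dy_homeo: "x \<in> dyadics \<Longrightarrow> dy_shift (dy_homeo x) x"
  using dy_shift_exists dy_homeo_eqI by metis

lemma dy_homeo_of_int: "dy_homeo (of_int m) = int_shift m"
  by (simp add: dy_homeo_eqI dy_shift_int_shift)

lemma dy_homeo_step:
  assumes "x \<in> dyadics" "x < of_int m"
  shows "dy_homeo x = finv (int_shift m) \<circ> dy_homeo (int_shift m x) \<circ> int_shift m"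
  using assms by (intro dy_homeo_eqI finv_int_shift_conj dy_shift_dy_homeo) auto

lemma dy_homeo_right: "x \<in> dyadics \<Longrightarrow> x \<le> t \<Longrightarrow> dy_homeo x t = t"
  using dy_shift_dy_homeo by (auto simp: dy_shift_def)

text \<open>For a non-integral \<open>x\<close> the map is a composition of \<open>h\<^sub>m\<close>, the map of \<open>h\<^sub>m(x)\<close> and the inverse of
  \<open>h\<^sub>m\<close>. Each factor preserves predecessors below the point to which \<open>x\<close> has been carried so far.\<close>

lemma dy_homeo_properties:
  assumes "x \<in> dyadics"
  shows "line_homeo (dy_homeo x) \<and> preserves_dyadics (dy_homeo x) \<and>
    preserves_dy_pred (dy_homeo x) x \<and> (\<forall>t<x. dy_homeo x t < t)"
  using assms
proof (induction rule: dyadic_induct)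
  case (int m)
  then show ?case
    by (auto simp: dy_homeo_of_int line_homeo_int_shift preserves_dyadics_int_shift
        preserves_dy_pred_int_shift) (auto simp: int_shift_def)
next
  case (step x m)
  let ?b = "int_shift m" let ?y = "int_shift m x"
  note L = line_homeo_int_shift[of m] and D = preserves_dyadics_int_shift[of m]
    and P = preserves_dy_pred_int_shift[of m]
  have eq: "dy_homeo x = finv ?b \<circ> dy_homeo ?y \<circ> ?b" using step by (intro dy_homeo_step)
  have m: "?b (of_int m) = of_int m" by (simp add: int_shift_right)
  have ym: "?y < of_int m" using line_homeo_less[OF L, of x "of_int m"] step m by simp
  have "preserves_dy_pred (dy_homeo ?y \<circ> ?b) x"
    using step L D by (intro preserves_dy_pred_comp preserves_dy_pred_mono[OF P]) auto
  moreover have "preserves_dy_pred (finv ?b) (dy_homeo ?y ?y)"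
    using preserves_dy_pred_mono[OF preserves_dy_pred_finv[OF P L D], of ?y] ym step m
    by (simp add: dy_homeo_right)
  ultimately have "preserves_dy_pred (finv ?b \<circ> (dy_homeo ?y \<circ> ?b)) x"
    using preserves_dy_pred_comp[of "dy_homeo ?y \<circ> ?b" x "finv ?b"] step L D
    by (simp add: line_homeo_comp preserves_dyadics_comp)
  moreover have "dy_homeo x t < t" if "t < x" for t
  proof -
    have "dy_homeo ?y (?b t) < ?b t" using step that L by simp
    then have "finv ?b (dy_homeo ?y (?b t)) < finv ?b (?b t)" using line_homeo_finv[OF L] by simp
    then show ?thesis using L by (simp add: eq)
  qed
  moreover have "line_homeo (dy_homeo x)" "preserves_dyadics (dy_homeo x)"
    unfolding eq
    by (intro line_homeo_comp preserves_dyadics_comp line_homeo_finv preserves_dyadics_finv L D;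
        use step in blast)+
  ultimately show ?case by (simp add: eq comp_assoc del: o_apply)
qed

text \<open>For \<open>f\<close> equal to \<open>h\<^sub>x\<close> or to a translation this is the defining relation of the trickle group and,
  evaluated at points, condition (g) of a trickle graph.\<close>

lemma dy_homeo_conj:
  assumes "preserves_dy_pred f x" "preserves_dyadics f" "line_homeo f" "y \<in> dyadics" "y < x"
  shows "dy_homeo (f y) \<circ> f = f \<circ> dy_homeo y"
proof -
  have "f y \<in> dyadics" using assms by (simp add: preserves_dyadics_def)
  then have "dy_homeo (f y) = f \<circ> dy_homeo y \<circ> finv f"
    using assms by (intro dy_homeo_eqI dy_shift_conj dy_shift_dy_homeo)
  then show ?thesis using assms(3) by (simp add: fun_eq_iff)
qed


section \<open>The trickle graph\<close>

definition vertex_map :: "ereal \<Rightarrow> real \<Rightarrow> real" where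
  "vertex_map x = (if x = \<infinity> then dy_homeo_infinity else dy_homeo (real_of_ereal x))"

lemma vertex_map_simps [simp]:
  "vertex_map \<infinity> = (\<lambda>t. t - 1)" "vertex_map (ereal r) = dy_homeo r"
  by (auto simp: vertex_map_def dy_homeo_infinity_def)

lemma dy_verts_cases [consumes 1, case_names infinity dyadic]:
  assumes "x \<in> dy_verts"
  obtains "x = \<infinity>" | r where "r \<in> dyadics" "x = ereal r"
  using assms by (auto simp: dy_verts_def)

lemma dy_verts_simps [simp]: "\<infinity> \<in> dy_verts" "ereal r \<in> dy_verts \<longleftrightarrow> r \<in> dyadics"
  by (auto simp: dy_verts_def)

lemma dy_aut_infinity [simp]: "dy_aut x \<infinity> = \<infinity>"
  by (simp add: dy_aut_def)

lemma dy_aut_ereal [simp]: "dy_aut x (ereal r) = ereal (vertex_map x r)"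
  by (simp add: dy_aut_def vertex_map_def)

lemma vertex_map_properties:
  assumes "x \<in> dy_verts"
  shows line_homeo_vertex_map: "line_homeo (vertex_map x)"
    and preserves_dyadics_vertex_map: "preserves_dyadics (vertex_map x)"
    and vertex_map_less: "ereal t < x \<Longrightarrow> vertex_map x t < t"
    and vertex_map_right: "x \<le> ereal t \<Longrightarrow> vertex_map x t = t"
proof -
  have "line_homeo (vertex_map x) \<and> preserves_dyadics (vertex_map x) \<and>
      (\<forall>t. ereal t < x \<longrightarrow> vertex_map x t < t) \<and> (\<forall>t. x \<le> ereal t \<longrightarrow> vertex_map x t = t)"
    using assms
  proof (cases x rule: dy_verts_cases)
    case infinity
    then show ?thesis
      using line_homeo_translation[of 1] by (simp add: preserves_dyadics_def)
  next
    case (dyadic r)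
    then show ?thesis using dy_homeo_properties[of r] dy_homeo_right[of r] by simp
  qed
  then show "line_homeo (vertex_map x)" "preserves_dyadics (vertex_map x)"
    "ereal t < x \<Longrightarrow> vertex_map x t < t" "x \<le> ereal t \<Longrightarrow> vertex_map x t = t"
    by simp_all
qed

lemma dy_aut_le_iff:
  assumes "x \<in> dy_verts" "y \<in> dy_verts" "z \<in> dy_verts"
  shows "dy_aut x y \<le> dy_aut x z \<longleftrightarrow> y \<le> z"
  using assms(2,3) line_homeo_vertex_map[OF assms(1)] by (auto elim!: dy_verts_cases)

lemma bij_betw_dy_aut:
  assumes "x \<in> dy_verts"
  shows "bij_betw (dy_aut x) dy_verts dy_verts"
proof -
  note L = line_homeo_vertex_map[OF assms] and D = preserves_dyadics_vertex_map[OF assms]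
  have "inj_on (dy_aut x) dy_verts"
    using dy_aut_le_iff[OF assms] by (intro inj_onI) (metis order_antisym order_refl)
  moreover have "dy_aut x ` dy_verts = dy_verts"
  proof
    show "dy_aut x ` dy_verts \<subseteq> dy_verts" using D by (auto elim!: dy_verts_cases simp: preserves_dyadics_def)
    show "dy_verts \<subseteq> dy_aut x ` dy_verts"
    proof
      fix y assume "y \<in> dy_verts"
      then show "y \<in> dy_aut x ` dy_verts"
      proof (cases y rule: dy_verts_cases)
        case infinity
        then show ?thesis by (metis dy_aut_infinity dy_verts_simps(1) image_eqI)
      next
        case (dyadic r)
        have "finv (vertex_map x) r \<in> dyadics"
          using preserves_dyadics_finv[OF L D] dyadic by (simp add: preserves_dyadics_def)
        moreover have "y = dy_aut x (ereal (finv (vertex_map x) r))" using L dyadic by simp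
        ultimately show ?thesis by (metis dy_verts_simps(2) image_eqI)
      qed
    qed
  qed
  ultimately show ?thesis by (simp add: bij_betw_def)
qed

lemma dy_aut_in_verts: "x \<in> dy_verts \<Longrightarrow> y \<in> dy_verts \<Longrightarrow> dy_aut x y \<in> dy_verts"
  using bij_betw_dy_aut bij_betwE by blast

lemma dy_aut_above:
  assumes "x \<in> dy_verts" "y \<in> dy_verts" "x \<le> y"
  shows "dy_aut x y = y"
  using assms(2) by (cases y rule: dy_verts_cases) (use assms in \<open>simp_all add: vertex_map_right\<close>)

lemma dy_aut_below:
  assumes "x \<in> dy_verts" "y \<in> dy_verts" "y < x"
  shows "dy_aut x y < x"
  using assms(2)
proof (cases y rule: dy_verts_cases)
  case (dyadic r)
  then have "vertex_map x r < r" using assms by (simp add: vertex_map_less)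
  then have "dy_aut x y < y" using dyadic by simp
  then show ?thesis using assms(3) by (rule less_trans)
qed (use assms in simp)

lemma vertex_map_conj:
  assumes "x \<in> dy_verts" "y \<in> dy_verts" "y < x"
  shows "vertex_map (dy_aut x y) \<circ> vertex_map x = vertex_map x \<circ> vertex_map y"
proof -
  obtain r where r: "r \<in> dyadics" "y = ereal r"
    using assms(2,3) by (cases y rule: dy_verts_cases) auto
  note L = line_homeo_vertex_map[OF assms(1)] and D = preserves_dyadics_vertex_map[OF assms(1)]
  show ?thesis
    using assms(1)
  proof (cases x rule: dy_verts_cases)
    case infinity
    then show ?thesis
      using dy_homeo_conj[OF preserves_dy_pred_translation[of "r + 1"], of r] L D r by simp
  next
    case (dyadic s)
    then show ?thesis
      using dy_homeo_conj[of "dy_homeo s" s r] dy_homeo_properties[of s] assms(3) r by simp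
  qed
qed

lemma star_dyadic_trickle_graph:
  "x \<in> dy_verts \<Longrightarrow> star dyadic_trickle_graph x = dy_verts"
  by (auto simp: star_def dyadic_trickle_graph_def)

lemma edges_dyadic_trickle_graph:
  "{x, y} \<in> edges dyadic_trickle_graph \<longleftrightarrow> x \<in> dy_verts \<and> y \<in> dy_verts \<and> x \<noteq> y"
  by (auto simp: dyadic_trickle_graph_def doubleton_eq_iff)

lemma dyadic_trickle_graph_simps [simp]:
  "verts dyadic_trickle_graph = dy_verts"
  "le dyadic_trickle_graph = {(x, y). x \<in> dy_verts \<and> y \<in> dy_verts \<and> x \<le> y}"
  "label dyadic_trickle_graph x = \<infinity>"
  "aut dyadic_trickle_graph = dy_aut"
  by (simp_all add: dyadic_trickle_graph_def)

lemma lt_dyadic_trickle_graph: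
  "lt dyadic_trickle_graph x y \<longleftrightarrow> x \<in> dy_verts \<and> y \<in> dy_verts \<and> x < y"
  by (auto simp: lt_def)

lemma par_edges_dyadic_trickle_graph: "par_edges dyadic_trickle_graph = {}"
  by (auto simp: par_edges_def edges_dyadic_trickle_graph)

text \<open>All vertices are comparable and all labels are infinite, so (b), (e) and (f) are immediate;
  (c) and (d) hold because the maps are increasing and fix everything from \<open>x\<close> on; (g) is
  \<open>vertex_map_conj\<close> evaluated at a point.\<close>

lemma trickle_graph_dyadic: "trickle_graph dyadic_trickle_graph"
  unfolding trickle_graph_def
proof (intro conjI)
  show "edges dyadic_trickle_graph \<subseteq>
      {{x, y} |x y. x \<in> verts dyadic_trickle_graph \<and> y \<in> verts dyadic_trickle_graph \<and> x \<noteq> y}"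
    by (auto simp: dyadic_trickle_graph_def)
  show "partial_order_on (verts dyadic_trickle_graph) (le dyadic_trickle_graph)"
    by (auto simp: partial_order_on_def preorder_on_def refl_on_def trans_def antisym_def)
  show "\<forall>x\<in>verts dyadic_trickle_graph.
      bij_betw (aut dyadic_trickle_graph x) (star dyadic_trickle_graph x) (star dyadic_trickle_graph x) \<and>
      (\<forall>y\<in>star dyadic_trickle_graph x. \<forall>z\<in>star dyadic_trickle_graph x.
        {y, z} \<in> edges dyadic_trickle_graph \<longleftrightarrow>
        {aut dyadic_trickle_graph x y, aut dyadic_trickle_graph x z} \<in> edges dyadic_trickle_graph)"
    by (simp add: star_dyadic_trickle_graph edges_dyadic_trickle_graph dy_aut_in_verts
        bij_betw_dy_aut) (metis bij_betw_dy_aut bij_betw_imp_inj_on inj_on_eq_iff)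
  show "\<forall>x\<in>verts dyadic_trickle_graph. \<forall>y\<in>star dyadic_trickle_graph x.
      \<forall>z\<in>star dyadic_trickle_graph x. (z, y) \<in> le dyadic_trickle_graph \<longleftrightarrow>
      (aut dyadic_trickle_graph x z, aut dyadic_trickle_graph x y) \<in> le dyadic_trickle_graph"
    by (auto simp: star_dyadic_trickle_graph dy_aut_in_verts dy_aut_le_iff)
  show "\<forall>x\<in>verts dyadic_trickle_graph. \<forall>y\<in>star dyadic_trickle_graph x.
      aut dyadic_trickle_graph x y \<noteq> y \<longrightarrow> lt dyadic_trickle_graph y x"
    by (simp add: star_dyadic_trickle_graph lt_dyadic_trickle_graph) (meson dy_aut_above not_le)
  show "\<forall>x y z. lt dyadic_trickle_graph z y \<and> lt dyadic_trickle_graph y x \<longrightarrow>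
      aut dyadic_trickle_graph x (aut dyadic_trickle_graph y z) =
      aut dyadic_trickle_graph (aut dyadic_trickle_graph x y) (aut dyadic_trickle_graph x z)"
  proof (intro allI impI)
    fix x y z
    assume "lt dyadic_trickle_graph z y \<and> lt dyadic_trickle_graph y x"
    then have x: "x \<in> dy_verts" and y: "y \<in> dy_verts" "y < x" and z: "z \<in> dy_verts"
      by (auto simp: lt_dyadic_trickle_graph)
    show "aut dyadic_trickle_graph x (aut dyadic_trickle_graph y z) =
        aut dyadic_trickle_graph (aut dyadic_trickle_graph x y) (aut dyadic_trickle_graph x z)"
      using z fun_cong[OF vertex_map_conj[OF x y]] by (cases z rule: dy_verts_cases) auto
  qed
qed (simp_all add: lt_dyadic_trickle_graph edges_dyadic_trickle_graph par_edges_dyadic_trickle_graph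
    less_imp_neq)


section \<open>Thompson's group through standard dyadic intervals\<close>

text \<open>\<open>f\<close> maps \<open>[j/2\<^sup>n, (j+1)/2\<^sup>n]\<close> linearly onto \<open>[c/2\<^sup>k, (c+1)/2\<^sup>k]\<close>; membership of \<open>t\<close> in the first
  interval is stated for \<open>2\<^sup>n t\<close> to keep the arithmetic among integers.\<close>

definition maps_standard :: "(real \<Rightarrow> real) \<Rightarrow> int \<Rightarrow> nat \<Rightarrow> int \<Rightarrow> nat \<Rightarrow> bool" where
  "maps_standard f j n c k \<longleftrightarrow> (\<forall>t. of_int j \<le> 2 ^ n * t \<and> 2 ^ n * t \<le> of_int j + 1 \<longrightarrow>
     f t = (of_int c + (2 ^ n * t - of_int j)) / 2 ^ k)"

lemma maps_standard_subinterval: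
  assumes "maps_standard f j n c k" "j * 2 ^ d \<le> i" "i + 1 \<le> (j + 1) * 2 ^ d"
  shows "maps_standard f i (n + d) (c * 2 ^ d + i - j * 2 ^ d) (k + d)"
  unfolding maps_standard_def
proof (intro allI impI)
  fix t :: real
  assume t: "of_int i \<le> 2 ^ (n + d) * t \<and> 2 ^ (n + d) * t \<le> of_int i + 1"
  have "of_int (j * 2 ^ d) \<le> (of_int i :: real)" "of_int (i + 1) \<le> (of_int ((j + 1) * 2 ^ d) :: real)"
    using assms(2,3) by (simp_all only: of_int_le_iff)
  then have "of_int j * 2 ^ d \<le> (of_int i :: real)" "of_int i + 1 \<le> (of_int j + 1) * (2 :: real) ^ d"
    by simp_all
  moreover have "(2 ^ n * t) * 2 ^ d = 2 ^ (n + d) * t" by (simp add: power_add)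
  ultimately have "of_int j * 2 ^ d \<le> (2 ^ n * t) * 2 ^ d" "(2 ^ n * t) * 2 ^ d \<le> (of_int j + 1) * 2 ^ d"
    using t by linarith+
  then have "of_int j \<le> 2 ^ n * t" "2 ^ n * t \<le> of_int j + 1" by simp_all
  then have "f t = (of_int c + (2 ^ n * t - of_int j)) / 2 ^ k"
    using assms(1) by (simp add: maps_standard_def)
  moreover have "of_int (c * 2 ^ d + i - j * 2 ^ d) + (2 ^ (n + d) * t - of_int i) =
      (of_int c + (2 ^ n * t - of_int j)) * 2 ^ d"
    by (simp add: power_add algebra_simps)
  ultimately show "f t = (of_int (c * 2 ^ d + i - j * 2 ^ d) + (2 ^ (n + d) * t - of_int i)) / 2 ^ (k + d)"
    by (simp add: power_add)
qed

lemma maps_standard_comp: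
  assumes "maps_standard g j n c k" "maps_standard f c k e l"
  shows "maps_standard (f \<circ> g) j n e l"
  unfolding maps_standard_def
proof (intro allI impI)
  fix t :: real
  assume t: "of_int j \<le> 2 ^ n * t \<and> 2 ^ n * t \<le> of_int j + 1"
  then have "2 ^ k * g t = of_int c + (2 ^ n * t - of_int j)"
    using assms(1) by (simp add: maps_standard_def)
  with t show "(f \<circ> g) t = (of_int e + (2 ^ n * t - of_int j)) / 2 ^ l"
    using assms(2) by (simp add: maps_standard_def)
qed

lemma maps_standard_finv:
  assumes "maps_standard f j n c k" "inj f"
  shows "maps_standard (finv f) c k j n"
  unfolding maps_standard_def
proof (intro allI impI)
  fix t :: real
  assume t: "of_int c \<le> 2 ^ k * t \<and> 2 ^ k * t \<le> of_int c + 1"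
  define s where "s = (of_int j + (2 ^ k * t - of_int c)) / 2 ^ n"
  have "2 ^ n * s = of_int j + (2 ^ k * t - of_int c)" by (simp add: s_def)
  then have "f s = t" using assms(1) t by (simp add: maps_standard_def)
  then show "finv f t = (of_int j + (2 ^ k * t - of_int c)) / 2 ^ n"
    using assms(2) by (metis inv_f_f s_def)
qed

text \<open>All sufficiently small standard dyadic intervals go to standard dyadic intervals, and the sizes
  change by a bounded factor. Unlike a list of breakpoints this is stable under composition for
  trivial reasons.\<close>

definition dyadic_PL :: "(real \<Rightarrow> real) \<Rightarrow> bool" where
  "dyadic_PL f \<longleftrightarrow>
    (\<exists>C. \<forall>n\<ge>C. \<forall>j. \<exists>c k. n \<le> k + C \<and> k \<le> n + C \<and> maps_standard f j n c k)"

lemma dyadic_PL_comp: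
  assumes "dyadic_PL f" "dyadic_PL g"
  shows "dyadic_PL (f \<circ> g)"
proof -
  obtain C where C: "\<And>n j. n \<ge> C \<Longrightarrow> \<exists>c k. n \<le> k + C \<and> k \<le> n + C \<and> maps_standard f j n c k"
    using assms(1) unfolding dyadic_PL_def by blast
  obtain D where D: "\<And>n j. n \<ge> D \<Longrightarrow> \<exists>c k. n \<le> k + D \<and> k \<le> n + D \<and> maps_standard g j n c k"
    using assms(2) unfolding dyadic_PL_def by blast
  have "\<exists>c k. n \<le> k + (C + D) \<and> k \<le> n + (C + D) \<and> maps_standard (f \<circ> g) j n c k"
    if "n \<ge> C + D" for n j
  proof -
    have "n \<ge> D" using that by simp
    then obtain c k where g: "n \<le> k + D" "k \<le> n + D" "maps_standard g j n c k"
      using D[of n j] by blast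
    then have "k \<ge> C" using that by linarith
    then obtain e l where "k \<le> l + C" "l \<le> k + C" "maps_standard f c k e l"
      using C[of k c] by blast
    then show ?thesis using g maps_standard_comp by (intro exI[of _ e] exI[of _ l]) auto
  qed
  then show ?thesis unfolding dyadic_PL_def by blast
qed

text \<open>A small standard interval \<open>I\<close> is covered by the image of a larger one: take a standard interval that
  contains the preimage of the midpoint of \<open>I\<close> and has a size for which its image is at least as long
  as \<open>I\<close>. Two standard intervals with a common interior point are nested.\<close>

lemma dyadic_PL_finv:
  assumes "dyadic_PL f" "line_homeo f"
  shows "dyadic_PL (finv f)"
proof -
  obtain C where C: "\<And>n j. n \<ge> C \<Longrightarrow> \<exists>c k. n \<le> k + C \<and> k \<le> n + C \<and> maps_standard f j n c k"
    using assms(1) unfolding dyadic_PL_def by blast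
  have "\<exists>c l. k \<le> l + 2 * C \<and> l \<le> k + 2 * C \<and> maps_standard (finv f) i k c l"
    if "k \<ge> 2 * C" for k i
  proof -
    \<comment> \<open>Sizes change by at most \<open>2\<^sup>C\<close>, hence an interval of length \<open>1/2\<^sup>n\<close> has an image of length at
      least \<open>1/2\<^sup>k\<close>.\<close>
    define n where "n = k - C"
    define t where "t = (of_int i + 1 / 2) / (2 :: real) ^ k"
    define s where "s = finv f t"
    define j where "j = \<lfloor>2 ^ n * s\<rfloor>"
    have j: "of_int j \<le> 2 ^ n * s" "2 ^ n * s < of_int j + 1" unfolding j_def by linarith+
    have "n \<ge> C" using that by (simp add: n_def)
    then obtain c l where l: "n \<le> l + C" "l \<le> n + C" and f: "maps_standard f j n c l"
      using C[of n j] by blast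
    define d where "d = k - l"
    have d: "k = l + d" using l that by (simp add: d_def n_def)
    have "f s = (of_int c + (2 ^ n * s - of_int j)) / 2 ^ l"
      using f j by (simp add: maps_standard_def)
    then have "t = (of_int c + (2 ^ n * s - of_int j)) / 2 ^ l"
      using assms(2) by (simp add: s_def)
    then have "2 ^ l * t = of_int c + (2 ^ n * s - of_int j)" by simp
    then have "of_int c \<le> 2 ^ l * t" "2 ^ l * t < of_int c + 1" using j by linarith+
    then have "of_int c * 2 ^ d \<le> (2 ^ l * t) * 2 ^ d" "(2 ^ l * t) * 2 ^ d < (of_int c + 1) * 2 ^ d"
      by simp_all
    moreover have "(2 ^ l * t) * 2 ^ d = of_int i + 1 / 2"
      by (simp add: t_def d power_add)
    ultimately have "real_of_int (c * 2 ^ d) < of_int (i + 1)" "real_of_int i < of_int ((c + 1) * 2 ^ d)"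
      by simp_all
    then have "c * 2 ^ d < i + 1" "i < (c + 1) * 2 ^ d" by (simp_all only: of_int_less_iff)
    then have "maps_standard (finv f) i (l + d) (j * 2 ^ d + i - c * 2 ^ d) (n + d)"
      using maps_standard_finv[OF f line_homeo_inj[OF assms(2)]]
      by (intro maps_standard_subinterval) auto
    moreover have "k \<le> (n + d) + 2 * C" "n + d \<le> k + 2 * C"
      using l d that by (auto simp: n_def)
    ultimately show ?thesis unfolding d by blast
  qed
  then show ?thesis unfolding dyadic_PL_def by blast
qed

definition integer_translation_ends :: "(real \<Rightarrow> real) \<Rightarrow> bool" where
  "integer_translation_ends f \<longleftrightarrow> (\<exists>(A :: int) (B :: int) (a :: int) (b :: int).
     (\<forall>t\<le> of_int A. f t = t + of_int a) \<and> (\<forall>t\<ge> of_int B. f t = t + of_int b))"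

lemma integer_translation_ends_comp:
  assumes "integer_translation_ends f" "integer_translation_ends g"
  shows "integer_translation_ends (f \<circ> g)"
proof -
  obtain A B a b :: int where f: "\<And>t. t \<le> of_int A \<Longrightarrow> f t = t + of_int a"
    "\<And>t. t \<ge> of_int B \<Longrightarrow> f t = t + of_int b"
    using assms(1) unfolding integer_translation_ends_def by blast
  obtain A' B' a' b' :: int where g: "\<And>t. t \<le> of_int A' \<Longrightarrow> g t = t + of_int a'"
    "\<And>t. t \<ge> of_int B' \<Longrightarrow> g t = t + of_int b'"
    using assms(2) unfolding integer_translation_ends_def by blast
  show ?thesis
    unfolding integer_translation_ends_def
    by (rule exI[of _ "min A' (A - a')"], rule exI[of _ "max B' (B - b')"],
        rule exI[of _ "a + a'"], rule exI[of _ "b + b'"]) (auto simp: f g)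
qed

lemma integer_translation_ends_finv:
  assumes "integer_translation_ends f" "line_homeo f"
  shows "integer_translation_ends (finv f)"
proof -
  obtain A B a b :: int where f: "\<And>t. t \<le> of_int A \<Longrightarrow> f t = t + of_int a"
    "\<And>t. t \<ge> of_int B \<Longrightarrow> f t = t + of_int b"
    using assms(1) unfolding integer_translation_ends_def by blast
  have "finv f t = t + of_int (- a)" if "t \<le> of_int (A + a)" for t
    using f(1)[of "t - of_int a"] that line_homeo_finv_f[OF assms(2), of "t - of_int a"] by simp
  moreover have "finv f t = t + of_int (- b)" if "t \<ge> of_int (B + b)" for t
    using f(2)[of "t - of_int b"] that line_homeo_finv_f[OF assms(2), of "t - of_int b"] by simp
  ultimately show ?thesis unfolding integer_translation_ends_def by blast
qed

text \<open>A description of \<open>F\<close> without breakpoints; the equivalence is \<open>thompson_map_iff\<close>.\<close>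

definition thompson_like :: "(real \<Rightarrow> real) \<Rightarrow> bool" where
  "thompson_like f \<longleftrightarrow> line_homeo f \<and> dyadic_PL f \<and> integer_translation_ends f"

lemma thompson_like_comp: "thompson_like f \<Longrightarrow> thompson_like g \<Longrightarrow> thompson_like (f \<circ> g)"
  by (simp only: thompson_like_def line_homeo_comp dyadic_PL_comp integer_translation_ends_comp)

lemma thompson_like_finv: "thompson_like f \<Longrightarrow> thompson_like (finv f)"
  by (simp only: thompson_like_def line_homeo_finv dyadic_PL_finv integer_translation_ends_finv)

lemma thompson_like_translation: "thompson_like (\<lambda>t. t - 1)"
proof -
  have "maps_standard (\<lambda>t. t - 1) j n (j - 2 ^ n) n" for j n
    by (simp add: maps_standard_def field_simps)
  then have "dyadic_PL (\<lambda>t. t - 1)" unfolding dyadic_PL_def by (metis order_refl add_0_right)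
  moreover have "integer_translation_ends (\<lambda>t. t - 1)"
    unfolding integer_translation_ends_def
    by (rule exI[of _ 0], rule exI[of _ 0], rule exI[of _ "-1"], rule exI[of _ "-1"]) simp
  ultimately show ?thesis by (simp add: thompson_like_def line_homeo_translation)
qed

lemma maps_standard_id: "maps_standard id j n j n"
  by (simp add: maps_standard_def)

lemma thompson_like_id: "thompson_like id"
proof -
  have "dyadic_PL id"
    unfolding dyadic_PL_def using maps_standard_id by (metis order_refl add_0_right)
  moreover have "integer_translation_ends id"
    unfolding integer_translation_ends_def by (metis add.right_neutral id_apply of_int_0)
  ultimately show ?thesis by (simp add: thompson_like_def line_homeo_id)
qed

text \<open>The breakpoints \<open>m - 1\<close> and \<open>m\<close> are integers, so a standard interval of length at most one lies
  in a single linear piece.\<close>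

lemma thompson_like_int_shift: "thompson_like (int_shift m)"
proof -
  have "\<exists>c k. n \<le> k + 1 \<and> k \<le> n + 1 \<and> maps_standard (int_shift m) j n c k" if n1: "n \<ge> 1" for n j
  proof -
    obtain l where n: "n = Suc l" using n1 by (metis not0_implies_Suc not_one_le_zero)
    consider "j + 1 \<le> 2 ^ n * (m - 1)" | "2 ^ n * (m - 1) \<le> j" "j + 1 \<le> 2 ^ n * m" | "2 ^ n * m \<le> j"
      by linarith
    then show ?thesis
    proof cases
      case 1
      then have "real_of_int (j + 1) \<le> of_int (2 ^ n * (m - 1))" by (simp only: of_int_le_iff)
      then have le: "real_of_int j + 1 \<le> 2 ^ n * (of_int m - 1)" by simp
      have "maps_standard (int_shift m) j n (j - 2 ^ n) n"
        unfolding maps_standard_def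
      proof (intro allI impI)
        fix t :: real
        assume "of_int j \<le> 2 ^ n * t \<and> 2 ^ n * t \<le> of_int j + 1"
        then have "2 ^ n * t \<le> 2 ^ n * (of_int m - 1)" using le by linarith
        then have "t \<le> of_int m - 1" by simp
        then show "int_shift m t = (of_int (j - 2 ^ n) + (2 ^ n * t - of_int j)) / 2 ^ n"
          by (simp add: int_shift_left diff_divide_distrib)
      qed
      then show ?thesis by (intro exI[of _ "j - 2 ^ n"] exI[of _ n]) simp
    next
      case 2
      then have "of_int (2 ^ n * (m - 1)) \<le> real_of_int j" "real_of_int (j + 1) \<le> of_int (2 ^ n * m)"
        by (simp_all only: of_int_le_iff)
      then have le: "2 ^ n * (of_int m - 1) \<le> real_of_int j" "real_of_int j + 1 \<le> 2 ^ n * of_int m"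
        by simp_all
      have "maps_standard (int_shift m) j n (j - 2 ^ l * m) l"
        unfolding maps_standard_def
      proof (intro allI impI)
        fix t :: real
        assume t: "of_int j \<le> 2 ^ n * t \<and> 2 ^ n * t \<le> of_int j + 1"
        then have "2 ^ n * (of_int m - 1) \<le> 2 ^ n * t" "2 ^ n * t \<le> 2 ^ n * of_int m"
          using le by linarith+
        then have "of_int m - 1 \<le> t" "t \<le> of_int m" by simp_all
        then have "int_shift m t = 2 * t - of_int m" by (rule int_shift_middle)
        then show "int_shift m t = (of_int (j - 2 ^ l * m) + (2 ^ n * t - of_int j)) / 2 ^ l"
          by (simp add: n diff_divide_distrib)
      qed
      then show ?thesis by (intro exI[of _ "j - 2 ^ l * m"] exI[of _ l]) (simp add: n)
    next
      case 3
      then have "of_int (2 ^ n * m) \<le> real_of_int j" by (simp only: of_int_le_iff)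
      then have le: "2 ^ n * of_int m \<le> real_of_int j" by simp
      have "maps_standard (int_shift m) j n j n"
        unfolding maps_standard_def
      proof (intro allI impI)
        fix t :: real
        assume "of_int j \<le> 2 ^ n * t \<and> 2 ^ n * t \<le> of_int j + 1"
        then have "2 ^ n * of_int m \<le> 2 ^ n * t" using le by linarith
        then have "of_int m \<le> t" by simp
        then show "int_shift m t = (of_int j + (2 ^ n * t - of_int j)) / 2 ^ n"
          by (simp add: int_shift_right)
      qed
      then show ?thesis by (intro exI[of _ j] exI[of _ n]) simp
    qed
  qed
  then have "dyadic_PL (int_shift m)" unfolding dyadic_PL_def by (intro exI[of _ 1]) blast
  moreover have "integer_translation_ends (int_shift m)"
    unfolding integer_translation_ends_def
    by (rule exI[of _ "m - 1"], rule exI[of _ m], rule exI[of _ "-1"], rule exI[of _ 0])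
      (simp add: int_shift_left int_shift_right)
  ultimately show ?thesis by (simp add: thompson_like_def line_homeo_int_shift)
qed

lemma thompson_like_dy_homeo: "x \<in> dyadics \<Longrightarrow> thompson_like (dy_homeo x)"
proof (induction rule: dyadic_induct)
  case (int m)
  then show ?case by (simp add: dy_homeo_of_int thompson_like_int_shift)
next
  case (step x m)
  then show ?case
    unfolding dy_homeo_step[OF step(1,3)]
    by (intro thompson_like_comp thompson_like_finv thompson_like_int_shift)
qed

lemma thompson_like_vertex_map: "x \<in> dy_verts \<Longrightarrow> thompson_like (vertex_map x)"
  by (cases x rule: dy_verts_cases) (auto simp: thompson_like_translation thompson_like_dy_homeo)

text \<open>The image has length \<open>1/2\<^sup>k\<close> for \<open>k = n - e\<close>. Both \<open>k\<close> and \<open>n\<close> are at least \<open>N\<close>, so \<open>v\<close> has an integral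
  numerator over \<open>2\<^sup>k\<close> and \<open>u\<close> over \<open>2\<^sup>n\<close>.\<close>

lemma maps_standard_of_affine:
  assumes f: "\<And>t. of_int j \<le> 2 ^ n * t \<Longrightarrow> 2 ^ n * t \<le> of_int j + 1 \<Longrightarrow> f t = v + 2 powi e * (t - u)"
    and "u * 2 ^ N \<in> \<int>" "v * 2 ^ N \<in> \<int>" "\<bar>e\<bar> \<le> int K" "n \<ge> N + K"
  shows "\<exists>c k. n \<le> k + K \<and> k \<le> n + K \<and> maps_standard f j n c k"
proof -
  define k where "k = nat (int n - e)"
  have k: "int k = int n - e" using assms(4,5) by (simp add: k_def)
  have pow: "2 powi e * 2 ^ k = (2 :: real) ^ n"
  proof -
    have "(2 :: real) powi e * 2 powi int k = 2 powi (e + int k)" by (simp add: power_int_add)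
    also have "e + int k = int n" using k by simp
    finally show ?thesis by (simp only: power_int_of_nat)
  qed
  have "N \<le> k" "N \<le> n" using k assms(4,5) by linarith+
  then have "v * 2 ^ k \<in> \<int>" "u * 2 ^ n \<in> \<int>" using assms(2,3) Ints_times_power2_mono by blast+
  then obtain p q where pq: "v * 2 ^ k = of_int p" "u * 2 ^ n = of_int q" by (auto elim!: Ints_cases)
  have "maps_standard f j n (p - q + j) k"
    unfolding maps_standard_def
  proof (intro allI impI)
    fix t :: real
    assume "of_int j \<le> 2 ^ n * t \<and> 2 ^ n * t \<le> of_int j + 1"
    then have "f t * 2 ^ k = v * 2 ^ k + (2 powi e * 2 ^ k) * (t - u)" by (simp add: f algebra_simps)
    also have "\<dots> = of_int p + 2 ^ n * t - of_int q"
      unfolding pow pq(1) by (simp add: right_diff_distrib pq(2)[symmetric])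
    finally show "f t = (of_int (p - q + j) + (2 ^ n * t - of_int j)) / 2 ^ k"
      by (simp add: field_simps)
  qed
  moreover have "n \<le> k + K" "k \<le> n + K" using k assms(4) by linarith+
  ultimately show ?thesis by blast
qed

lemma finite_dyadics_common_denominator:
  assumes "finite S" "S \<subseteq> dyadics"
  shows "\<exists>N. \<forall>x\<in>S. x * 2 ^ N \<in> \<int>"
  using assms
proof (induction rule: finite_induct)
  case (insert x S)
  then obtain N where N: "\<forall>y\<in>S. y * 2 ^ N \<in> \<int>" by auto
  obtain M where M: "x * 2 ^ M \<in> \<int>" using insert by (auto simp: dyadics_iff)
  have "\<forall>y\<in>insert x S. y * 2 ^ max N M \<in> \<int>"
    using N M by (auto intro: Ints_times_power2_mono)
  then show ?case by blast
qed simp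

text \<open>Once \<open>2\<^sup>l\<close> is a common denominator of the breakpoints, no interval of length \<open>1/2\<^sup>l\<close> contains a
  breakpoint in its interior, so \<open>maps_standard_of_affine\<close> applies to it.\<close>

lemma thompson_like_of_thompson_map:
  assumes "thompson_map f"
  shows "thompson_like f"
proof -
  obtain n :: nat and u v :: "nat \<Rightarrow> real" where
    dy: "u ` {0..n} \<subseteq> dyadics" "v ` {0..n} \<subseteq> dyadics"
    and mid: "\<forall>i\<in>{1..n}. linear_onto f (u (i - 1)) (u i) (v (i - 1)) (v i) \<and>
        (\<exists>k :: int. (v i - v (i - 1)) / (u i - u (i - 1)) = 2 powi k)"
    and left: "v 0 - u 0 \<in> \<int>" "\<forall>t\<le>u 0. f t = t + v 0 - u 0"
    and right: "v n - u n \<in> \<int>" "\<forall>t\<ge>u n. f t = t + v n - u n"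
    using assms unfolding thompson_map_def by blast
  obtain e where e: "\<And>i. i \<in> {1..n} \<Longrightarrow> (v i - v (i - 1)) / (u i - u (i - 1)) = 2 powi (e i :: int)"
    using mid by metis
  obtain N where "\<forall>x\<in>u ` {0..n} \<union> v ` {0..n}. x * 2 ^ N \<in> \<int>"
    using finite_dyadics_common_denominator[of "u ` {0..n} \<union> v ` {0..n}"] dy by auto
  then have N: "x * 2 ^ N \<in> \<int>" if "x \<in> u ` {0..n} \<union> v ` {0..n}" for x
    using that by blast
  \<comment> \<open>A common bound for the exponents of the slopes.\<close>
  define K where "K = (\<Sum>i\<in>{1..n}. nat \<bar>e i\<bar>)"
  have K: "\<bar>e i\<bar> \<le> int K" if "i \<in> {1..n}" for i
  proof -
    have "nat \<bar>e i\<bar> \<le> K" unfolding K_def using that by (intro member_le_sum) auto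
    then show ?thesis by linarith
  qed
  have "\<exists>c k. l \<le> k + (N + K) \<and> k \<le> l + (N + K) \<and> maps_standard f j l c k"
    if l: "l \<ge> N + K" for l j
  proof -
    have int_u: "\<exists>q. 2 ^ l * u i = of_int q" if "i \<le> n" for i
      using Ints_times_power2_mono[of "u i" N l] N[of "u i"] that l
      by (auto elim!: Ints_cases simp: mult.commute)
    have below: "2 ^ l * u i \<le> of_int j" if i: "i \<le> n" "\<not> of_int j + 1 \<le> 2 ^ l * u i" for i
    proof -
      obtain q where q: "2 ^ l * u i = of_int q" using int_u i by blast
      with i have "real_of_int q < of_int (j + 1)" by simp
      then have "q \<le> j" by (simp only: of_int_less_iff)
      then show ?thesis by (simp add: q)
    qed
    have "\<exists>c k. l \<le> k + K \<and> k \<le> l + K \<and> maps_standard f j l c k"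
    proof (cases "of_int j + 1 \<le> 2 ^ l * u n")
      case False
      have f: "f t = v n + 2 powi 0 * (t - u n)" if "of_int j \<le> 2 ^ l * t" for t
      proof -
        have "2 ^ l * u n \<le> 2 ^ l * t" using below[of n] False that by linarith
        then have "u n \<le> t" by simp
        then show ?thesis using right by simp
      qed
      show ?thesis
        by (rule maps_standard_of_affine[where u = "u n" and v = "v n" and e = 0 and N = N])
          (use f N l in auto)
    next
      case True
      define i where "i = (LEAST i. of_int j + 1 \<le> 2 ^ l * u i)"
      have i: "of_int j + 1 \<le> 2 ^ l * u i" unfolding i_def using True by (rule LeastI)
      have "i \<le> n" unfolding i_def using True by (rule Least_le)
      show ?thesis
      proof (cases "i = 0")
        case True
        have f: "f t = v 0 + 2 powi 0 * (t - u 0)" if "2 ^ l * t \<le> of_int j + 1" for t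
        proof -
          have "2 ^ l * t \<le> 2 ^ l * u 0" using i[unfolded True] that by linarith
          then have "t \<le> u 0" by simp
          then show ?thesis using left by simp
        qed
        show ?thesis
          by (rule maps_standard_of_affine[where u = "u 0" and v = "v 0" and e = 0 and N = N])
            (use f N l in auto)
      next
        case False
        then have "i - 1 < i" by simp
        then have "\<not> of_int j + 1 \<le> 2 ^ l * u (i - 1)" unfolding i_def by (rule not_less_Least)
        then have lo: "2 ^ l * u (i - 1) \<le> of_int j" using below \<open>i \<le> n\<close> by simp
        have i1: "i \<in> {1..n}" using False \<open>i \<le> n\<close> by auto
        have f: "f t = v (i - 1) + 2 powi (e i) * (t - u (i - 1))"
          if "of_int j \<le> 2 ^ l * t" "2 ^ l * t \<le> of_int j + 1" for t
        proof -
          have "2 ^ l * u (i - 1) \<le> 2 ^ l * t" "2 ^ l * t \<le> 2 ^ l * u i"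
            using lo i that by linarith+
          then have "t \<in> {u (i - 1)..u i}" by simp
          then show ?thesis using mid i1 unfolding linear_onto_def e[OF i1, symmetric] by blast
        qed
        show ?thesis
          by (rule maps_standard_of_affine[where u = "u (i - 1)" and v = "v (i - 1)" and e = "e i" and N = N])
            (use f N l K[OF i1] i1 in auto)
      qed
    qed
    then show ?thesis by (meson add_le_mono le_add2 le_trans order_refl)
  qed
  then have "dyadic_PL f" unfolding dyadic_PL_def by blast
  moreover have "integer_translation_ends f"
  proof -
    obtain a b where ab: "v 0 - u 0 = of_int a" "v n - u n = of_int b"
      using left(1) right(1) by (auto elim!: Ints_cases)
    have "f t = t + of_int a" if "t \<le> of_int \<lfloor>u 0\<rfloor>" for t
    proof -
      have "t \<le> u 0" using that by linarith
      then have "f t = t + v 0 - u 0" using left(2) by blast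
      then show ?thesis using ab by simp
    qed
    moreover have "f t = t + of_int b" if "t \<ge> of_int \<lceil>u n\<rceil>" for t
    proof -
      have "t \<ge> u n" using that by linarith
      then have "f t = t + v n - u n" using right(2) by blast
      then show ?thesis using ab by simp
    qed
    ultimately show ?thesis unfolding integer_translation_ends_def by blast
  qed
  moreover have "line_homeo f"
    using assms by (auto simp: thompson_map_def line_homeo_def homeomorphism_def)
  ultimately show ?thesis by (simp add: thompson_like_def)
qed

lemma continuous_on_line_homeo: "line_homeo f \<Longrightarrow> continuous_on UNIV f"
  by (rule continuous_onI_mono) (auto simp: line_homeo_def strict_mono_less_eq)

lemma homeomorphism_line_homeo:
  assumes "line_homeo f"
  shows "homeomorphism UNIV UNIV f (finv f)"
  using assms line_homeo_finv[OF assms]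
  by (auto simp: homeomorphism_def continuous_on_line_homeo line_homeo_def)

text \<open>As breakpoints serve all multiples of \<open>1/2\<^sup>C\<close> between two integers beyond which the map is a
  translation.\<close>

lemma thompson_map_of_thompson_like:
  assumes "thompson_like f"
  shows "thompson_map f"
proof -
  have L: "line_homeo f" using assms by (simp add: thompson_like_def)
  obtain C where C: "\<And>n j. n \<ge> C \<Longrightarrow> \<exists>c k. n \<le> k + C \<and> k \<le> n + C \<and> maps_standard f j n c k"
    using assms unfolding thompson_like_def dyadic_PL_def by blast
  obtain A B a b :: int where f: "\<And>t. t \<le> of_int A \<Longrightarrow> f t = t + of_int a"
    "\<And>t. t \<ge> of_int B \<Longrightarrow> f t = t + of_int b"
    using assms unfolding thompson_like_def integer_translation_ends_def by blast
  define n where "n = nat (B - A) * 2 ^ C"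
  define u where "u i = of_int (A * 2 ^ C + int i) / (2 :: real) ^ C" for i :: nat
  define v where "v i = f (u i)" for i :: nat
  have u0: "u 0 = of_int A" by (simp add: u_def)
  have un: "of_int B \<le> u n" "u n \<in> \<int>"
  proof -
    have "u n = of_int (A + int (nat (B - A)))" by (simp add: u_def n_def field_simps)
    moreover have "B \<le> A + int (nat (B - A))" by simp
    ultimately show "of_int B \<le> u n" "u n \<in> \<int>" by (simp_all only: of_int_le_iff Ints_of_int)
  qed
  have u_less: "u i < u k" if "i < k" for i k using that by (simp add: u_def divide_strict_right_mono)
  have "strict_mono_on {0..n} u" "strict_mono_on {0..n} v"
    using u_less L by (auto simp: strict_mono_on_def v_def)
  moreover have "u ` {0..n} \<subseteq> dyadics" unfolding u_def by (auto simp del: of_int_add of_int_mult)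
  moreover have step: "\<exists>c k. v i = of_int c / 2 ^ k \<and> v (Suc i) = of_int (c + 1) / 2 ^ k \<and>
      linear_onto f (u i) (u (Suc i)) (v i) (v (Suc i)) \<and>
      (v (Suc i) - v i) / (u (Suc i) - u i) = 2 powi (int C - int k)" for i
  proof -
    obtain c k where m: "maps_standard f (A * 2 ^ C + int i) C c k"
      using C[of C] by blast
    have i: "2 ^ C * u i = of_int (A * 2 ^ C + int i)"
      and Si: "2 ^ C * u (Suc i) = of_int (A * 2 ^ C + int i) + 1"
      by (simp_all add: u_def)
    have "f t = (of_int c + (2 ^ C * t - 2 ^ C * u i)) / 2 ^ k" if "u i \<le> t" "t \<le> u (Suc i)" for t
    proof -
      have "2 ^ C * u i \<le> 2 ^ C * t" "2 ^ C * t \<le> 2 ^ C * u (Suc i)" using that by simp_all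
      then show ?thesis using m unfolding i Si maps_standard_def by simp
    qed
    note f = this
    have vi: "v i = of_int c / 2 ^ k"
      unfolding v_def by (subst f) (use u_less[of i "Suc i"] in auto)
    have vSi: "v (Suc i) = of_int (c + 1) / 2 ^ k"
      unfolding v_def by (subst f) (use u_less[of i "Suc i"] i Si in auto)
    have du: "u (Suc i) - u i = 1 / 2 ^ C" by (simp add: u_def field_simps)
    have dv: "v (Suc i) - v i = 1 / 2 ^ k" unfolding vi vSi by (simp add: field_simps)
    have "linear_onto f (u i) (u (Suc i)) (v i) (v (Suc i))"
    proof (rule linear_ontoI[where s = "2 ^ C / 2 ^ k"])
      fix t assume "u i \<le> t" "t \<le> u (Suc i)"
      then show "f t = v i + 2 ^ C / 2 ^ k * (t - u i)"
        unfolding vi by (subst f) (simp_all add: field_simps)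
    qed (use u_less du dv in \<open>simp_all add: field_simps\<close>)
    moreover have "(v (Suc i) - v i) / (u (Suc i) - u i) = 2 powi (int C - int k)"
      unfolding du dv by (simp add: power_int_diff)
    ultimately show ?thesis using vi vSi by blast
  qed
  moreover have "v ` {0..n} \<subseteq> dyadics"
    using step by (force simp: dyadics_def)
  moreover have "\<forall>i\<in>{1..n}. linear_onto f (u (i - 1)) (u i) (v (i - 1)) (v i) \<and>
      (\<exists>k :: int. (v i - v (i - 1)) / (u i - u (i - 1)) = 2 powi k)"
  proof
    fix i assume "i \<in> {1..n}"
    then have "i = Suc (i - 1)" by simp
    then show "linear_onto f (u (i - 1)) (u i) (v (i - 1)) (v i) \<and>
      (\<exists>k :: int. (v i - v (i - 1)) / (u i - u (i - 1)) = 2 powi k)"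
      using step[of "i - 1"] by metis
  qed
  moreover have "v 0 - u 0 \<in> \<int>" "\<forall>t\<le>u 0. f t = t + v 0 - u 0"
    using f(1) by (simp_all add: u0 v_def)
  moreover have "v n - u n \<in> \<int>" "\<forall>t\<ge>u n. f t = t + v n - u n"
    using f(2) un by (simp_all add: v_def)
  moreover have "strict_mono f" using L by (simp add: line_homeo_def)
  ultimately show ?thesis
    unfolding thompson_map_def using homeomorphism_line_homeo[OF L] by blast
qed

lemma thompson_map_iff: "thompson_map f \<longleftrightarrow> thompson_like f"
  using thompson_like_of_thompson_map thompson_map_of_thompson_like by blast


section \<open>Words in a presented group\<close>

lemma words_Nil [simp]: "[] \<in> words S"
  and words_Cons [simp]: "a # u \<in> words S \<longleftrightarrow> fst a \<in> S \<and> u \<in> words S"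
  and words_append [simp]: "u @ v \<in> words S \<longleftrightarrow> u \<in> words S \<and> v \<in> words S"
  by (auto simp: words_def mem_Times_iff)

lemma words_mono: "u \<in> words S \<Longrightarrow> S \<subseteq> T \<Longrightarrow> u \<in> words T"
  by (induction u) auto

lemma pres_eq_context:
  "pres_eq S R u v \<Longrightarrow> a \<in> words S \<Longrightarrow> b \<in> words S \<Longrightarrow> pres_eq S R (a @ u @ b) (a @ v @ b)"
  by (intro pres_eq.append pres_eq.refl)

definition inv_letter :: "'s \<times> bool \<Rightarrow> 's \<times> bool" where
  "inv_letter a = (fst a, \<not> snd a)"

lemma fst_inv_letter [simp]: "fst (inv_letter a) = fst a"
  by (simp add: inv_letter_def)

lemma pres_eq_cancel_right: "fst a \<in> S \<Longrightarrow> pres_eq S R [a, inv_letter a] []"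
  using pres_eq.cancel[of "fst a" S R "snd a"] by (simp add: inv_letter_def)

lemma pres_eq_cancel_left: "fst a \<in> S \<Longrightarrow> pres_eq S R [inv_letter a, a] []"
  using pres_eq.cancel[of "fst a" S R "\<not> snd a"] by (simp add: inv_letter_def)

text \<open>This and the next lemma express that \<open>a b = c a\<close> implies \<open>a b\<^sup>-\<^sup>1 = c\<^sup>-\<^sup>1 a\<close> and \<open>a\<^sup>-\<^sup>1 c = b a\<^sup>-\<^sup>1\<close>.\<close>

lemma swap_inverse_right:
  assumes "pres_eq S R [a, b] [c, a]" "fst a \<in> S" "fst b \<in> S" "fst c \<in> S"
  shows "pres_eq S R [a, inv_letter b] [inv_letter c, a]"
proof -
  have 1: "pres_eq S R [a, inv_letter b] [inv_letter c, c, a, inv_letter b]"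
    using pres_eq_context[OF pres_eq.sym[OF pres_eq_cancel_left[OF assms(4)]], of "[]" "[a, inv_letter b]"]
      assms by simp
  have 2: "pres_eq S R [inv_letter c, c, a, inv_letter b] [inv_letter c, a, b, inv_letter b]"
    using pres_eq_context[OF pres_eq.sym[OF assms(1)], of "[inv_letter c]" "[inv_letter b]"] assms by simp
  have 3: "pres_eq S R [inv_letter c, a, b, inv_letter b] [inv_letter c, a]"
    using pres_eq_context[OF pres_eq_cancel_right[OF assms(3)], of "[inv_letter c, a]" "[]"] assms by simp
  show ?thesis by (rule pres_eq.trans[OF 1 pres_eq.trans[OF 2 3]])
qed

lemma swap_inverse_left:
  assumes "pres_eq S R [a, b] [c, a]" "fst a \<in> S" "fst b \<in> S" "fst c \<in> S"
  shows "pres_eq S R [inv_letter a, c] [b, inv_letter a]"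
proof -
  have 1: "pres_eq S R [inv_letter a, c] [inv_letter a, c, a, inv_letter a]"
    using pres_eq_context[OF pres_eq.sym[OF pres_eq_cancel_right[OF assms(2)]], of "[inv_letter a, c]" "[]"]
      assms by simp
  have 2: "pres_eq S R [inv_letter a, c, a, inv_letter a] [inv_letter a, a, b, inv_letter a]"
    using pres_eq_context[OF pres_eq.sym[OF assms(1)], of "[inv_letter a]" "[inv_letter a]"] assms by simp
  have 3: "pres_eq S R [inv_letter a, a, b, inv_letter a] [b, inv_letter a]"
    using pres_eq_context[OF pres_eq_cancel_left[OF assms(2)], of "[]" "[b, inv_letter a]"] assms by simp
  show ?thesis by (rule pres_eq.trans[OF 1 pres_eq.trans[OF 2 3]])
qed

lemma pres_eq_replicate:
  assumes "x \<in> S" "P \<in> words {x}"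
  shows "\<exists>n e. pres_eq S R P (replicate n (x, e))"
  using assms(2)
proof (induction P)
  case Nil
  then show ?case by (intro exI[of _ 0]) (simp add: pres_eq.refl)
next
  case (Cons a P)
  have aS: "fst a = x" "fst a \<in> S" using Cons.prems assms(1) by auto
  obtain n e where ne: "pres_eq S R P (replicate n (x, e))" using Cons by auto
  have P: "pres_eq S R (a # P) (a # replicate n (x, e))"
    using pres_eq_context[OF ne, of "[a]" "[]"] aS by simp
  have rep: "replicate k (x, e) \<in> words S" for k using assms(1) by (induction k) auto
  show ?case
  proof (cases "a = (x, e)")
    case True
    then show ?thesis using P by (intro exI[of _ "Suc n"] exI[of _ e]) simp
  next
    case False
    then have a: "(x, e) = inv_letter a" using aS by (cases a) (auto simp: inv_letter_def)
    show ?thesis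
    proof (cases n)
      case 0
      then show ?thesis using P aS by (intro exI[of _ 1] exI[of _ "snd a"]) (cases a, simp)
    next
      case (Suc m)
      have "pres_eq S R ([] @ [a, inv_letter a] @ replicate m (x, e)) ([] @ [] @ replicate m (x, e))"
        using aS rep by (intro pres_eq_context pres_eq_cancel_right) auto
      then have "pres_eq S R (a # replicate n (x, e)) (replicate m (x, e))" by (simp add: Suc a)
      then show ?thesis using pres_eq.trans[OF P] by blast
    qed
  qed
qed


section \<open>The action of the trickle group on the line\<close>

definition dy_relations :: "(ereal word \<times> ereal word) set" where
  "dy_relations = {([(dy_aut x y, True), (x, True)], [(dy_aut y x, True), (y, True)]) | x y.
     x \<in> dy_verts \<and> y \<in> dy_verts \<and> x \<noteq> y}"

text \<open>All labels are infinite, so no power of a generator is a relator.\<close>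

lemma trickle_group_dyadic:
  "trickle_group dyadic_trickle_graph = presented_group dy_verts dy_relations"
  by (simp add: trickle_group_def dy_relations_def edges_dyadic_trickle_graph)

abbreviation trickle_eq :: "ereal word \<Rightarrow> ereal word \<Rightarrow> bool" (infix "\<approx>\<^sub>T" 50) where
  "u \<approx>\<^sub>T v \<equiv> pres_eq dy_verts dy_relations u v"

abbreviation letter_map :: "ereal \<times> bool \<Rightarrow> real \<Rightarrow> real" where
  "letter_map a \<equiv> (if snd a then vertex_map (fst a) else finv (vertex_map (fst a)))"

fun word_map :: "ereal word \<Rightarrow> real \<Rightarrow> real" where
  "word_map [] = id"
| "word_map (a # w) = letter_map a \<circ> word_map w"

lemma word_map_append: "word_map (u @ v) = word_map u \<circ> word_map v"
  by (induction u) (auto simp: comp_assoc)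

lemma thompson_like_word_map: "w \<in> words dy_verts \<Longrightarrow> thompson_like (word_map w)"
  by (induction w) (auto simp del: o_apply
      intro: thompson_like_id thompson_like_comp thompson_like_finv thompson_like_vertex_map)

lemma line_homeo_word_map: "w \<in> words dy_verts \<Longrightarrow> line_homeo (word_map w)"
  using thompson_like_word_map by (simp add: thompson_like_def)

lemma word_map_relation:
  assumes "(u, v) \<in> dy_relations"
  shows "word_map u = word_map v"
proof -
  have *: "vertex_map (dy_aut x y) \<circ> vertex_map x = vertex_map (dy_aut y x) \<circ> vertex_map y"
    if "x \<in> dy_verts" "y \<in> dy_verts" "y < x" for x y
    using vertex_map_conj[OF that] dy_aut_above[of y x] that by simp
  obtain x y where "u = [(dy_aut x y, True), (x, True)]" "v = [(dy_aut y x, True), (y, True)]"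
    "x \<in> dy_verts" "y \<in> dy_verts" "x \<noteq> y"
    using assms unfolding dy_relations_def by blast
  then show ?thesis using *[of x y] *[of y x] by (cases x y rule: linorder_cases) auto
qed

lemma word_map_cong: "u \<approx>\<^sub>T v \<Longrightarrow> word_map u = word_map v"
proof (induction rule: pres_eq.induct)
  case (rel u v)
  then show ?case using word_map_relation by blast
next
  case (cancel s e)
  then show ?case using line_homeo_vertex_map[of s] by (cases e) (auto simp: fun_eq_iff)
qed (simp_all add: word_map_append)

lemma dy_relationsI:
  assumes "x \<in> dy_verts" "y \<in> dy_verts" "x \<noteq> y"
  shows "([(dy_aut x y, True), (x, True)], [(dy_aut y x, True), (y, True)]) \<in> dy_relations"
  unfolding dy_relations_def by (rule CollectI, rule exI[of _ x], rule exI[of _ y]) (use assms in simp)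

text \<open>For a positive letter \<open>x\<close> this is the relation of the edge between \<open>x\<close> and \<open>y\<close>, possibly with \<open>y\<close> inverted.
  For an inverse letter it is the same relation at the preimage of \<open>y\<close> under \<open>dy_aut x\<close>.\<close>

lemma letter_swap:
  assumes "x \<in> dy_verts" "y \<in> dy_verts" "y < x"
  shows "\<exists>y'\<in>dy_verts. y' < x \<and> [(x, e), (y, d)] \<approx>\<^sub>T [(y', d), (x, e)]"
proof -
  have swap: "[(x, True), (z, True)] \<approx>\<^sub>T [(dy_aut x z, True), (x, True)]"
    "[(x, True), (z, False)] \<approx>\<^sub>T [(dy_aut x z, False), (x, True)]" if z: "z \<in> dy_verts" "z < x" for z
  proof -
    have "([(dy_aut x z, True), (x, True)], [(dy_aut z x, True), (z, True)]) \<in> dy_relations"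
      using assms(1) z by (intro dy_relationsI) auto
    then have "([(dy_aut x z, True), (x, True)], [(x, True), (z, True)]) \<in> dy_relations"
      using dy_aut_above[OF z(1) assms(1) less_imp_le[OF z(2)]] by simp
    then show 1: "[(x, True), (z, True)] \<approx>\<^sub>T [(dy_aut x z, True), (x, True)]"
      by (rule pres_eq.sym[OF pres_eq.rel]) (use assms z dy_aut_in_verts[OF assms(1) z(1)] in simp_all)
    show "[(x, True), (z, False)] \<approx>\<^sub>T [(dy_aut x z, False), (x, True)]"
      using swap_inverse_right[OF 1] assms z dy_aut_in_verts[OF assms(1) z(1)] by (simp add: inv_letter_def)
  qed
  show ?thesis
  proof (cases e)
    case True
    then have "[(x, e), (y, d)] \<approx>\<^sub>T [(dy_aut x y, d), (x, e)]"
      using swap[OF assms(2,3)] by (cases d) simp_all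
    then show ?thesis
      using dy_aut_in_verts[OF assms(1,2)] dy_aut_below[OF assms] by (intro bexI[of _ "dy_aut x y"] conjI)
  next
    case False
    obtain z where z: "z \<in> dy_verts" "y = dy_aut x z"
      using bij_betw_imp_surj_on[OF bij_betw_dy_aut[OF assms(1)]] assms(2) by (metis imageE)
    have "z < x"
    proof (rule ccontr)
      assume "\<not> z < x"
      then have "dy_aut x z = z" using dy_aut_above[OF assms(1) z(1)] by simp
      then show False using assms(3) z(2) \<open>\<not> z < x\<close> by simp
    qed
    note s = swap[OF z(1) this, folded z(2)]
    have "[(x, False), (y, d)] \<approx>\<^sub>T [(z, d), (x, False)]"
      using swap_inverse_left[OF s(1)] swap_inverse_left[OF s(2)] assms(1,2) z(1)
      by (cases d) (simp_all add: inv_letter_def)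
    then show ?thesis using False z(1) \<open>z < x\<close> by (intro bexI[of _ z] conjI) simp_all
  qed
qed

abbreviation dy_verts_below :: "ereal \<Rightarrow> ereal set" where
  "dy_verts_below x \<equiv> {y \<in> dy_verts. y < x}"

lemma words_below: "u \<in> words (dy_verts_below x) \<Longrightarrow> u \<in> words dy_verts"
  by (rule words_mono) auto

lemma move_letter_right:
  assumes "x \<in> dy_verts" "u \<in> words (dy_verts_below x)"
  shows "\<exists>v\<in>words (dy_verts_below x). length v = length u \<and> (x, e) # u \<approx>\<^sub>T v @ [(x, e)]"
  using assms(2)
proof (induction u)
  case Nil
  then show ?case using assms(1) by (intro bexI[of _ "[]"]) (auto intro: pres_eq.refl)
next
  case (Cons a u)
  obtain y d where a: "a = (y, d)" by force
  obtain y' where y': "y' \<in> dy_verts" "y' < x" "[(x, e), (y, d)] \<approx>\<^sub>T [(y', d), (x, e)]"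
    using letter_swap[OF assms(1), of y e d] Cons.prems a by auto
  obtain v where v: "v \<in> words (dy_verts_below x)" "length v = length u" "(x, e) # u \<approx>\<^sub>T v @ [(x, e)]"
    using Cons by auto
  have "u \<in> words dy_verts" using Cons.prems by (auto intro: words_below)
  then have 1: "(x, e) # a # u \<approx>\<^sub>T (y', d) # (x, e) # u"
    using pres_eq_context[OF y'(3), of "[]" u] by (simp add: a)
  have 2: "(y', d) # (x, e) # u \<approx>\<^sub>T ((y', d) # v) @ [(x, e)]"
    using pres_eq_context[OF v(3), of "[(y', d)]" "[]"] y'(1) by simp
  note pres_eq.trans[OF 1 2]
  then show ?case using v y' by (intro bexI[of _ "(y', d) # v"]) auto
qed

text \<open>The length is recorded because it decreases strictly when \<open>x\<close> occurs in the word; this drives the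
  induction in \<open>trivial_word_map\<close>.\<close>

lemma collect_letter:
  assumes "x \<in> dy_verts" "w \<in> words {y \<in> dy_verts. y \<le> x}"
  shows "\<exists>u\<in>words (dy_verts_below x). \<exists>P\<in>words {x}.
    length u = length (filter (\<lambda>a. fst a \<noteq> x) w) \<and> w \<approx>\<^sub>T u @ P"
  using assms(2)
proof (induction w)
  case Nil
  then show ?case by (intro bexI[of _ "[]"]) (auto intro: pres_eq.refl)
next
  case (Cons a w)
  then obtain u P where IH: "u \<in> words (dy_verts_below x)" "P \<in> words {x}"
    "length u = length (filter (\<lambda>a. fst a \<noteq> x) w)" "w \<approx>\<^sub>T u @ P"
    by auto
  have P: "P \<in> words dy_verts" using IH(2) assms(1) by (auto intro: words_mono)
  have aw: "a # w \<approx>\<^sub>T a # u @ P"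
    using pres_eq_context[OF IH(4), of "[a]" "[]"] Cons.prems by simp
  show ?case
  proof (cases "fst a = x")
    case True
    then obtain e where a: "a = (x, e)" by (cases a) auto
    obtain v where v: "v \<in> words (dy_verts_below x)" "length v = length u" "(x, e) # u \<approx>\<^sub>T v @ [(x, e)]"
      using move_letter_right[OF assms(1) IH(1)] by blast
    have "[] @ ((x, e) # u) @ P \<approx>\<^sub>T [] @ (v @ [(x, e)]) @ P"
      using v P by (intro pres_eq_context) auto
    then have "a # w \<approx>\<^sub>T v @ ((x, e) # P)" using pres_eq.trans[OF aw] by (simp add: a)
    then show ?thesis using v IH a by (intro bexI[of _ v] bexI[of _ "(x, e) # P"]) auto
  next
    case False
    then show ?thesis
      using aw IH Cons.prems by (intro bexI[of _ "a # u"] bexI[of _ P]) auto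
  qed
qed

text \<open>The finitely many letters act trivially from the largest of them on, which is below \<open>x\<close>.\<close>

lemma word_map_below_fixes:
  assumes "x \<in> dy_verts" "u \<in> words (dy_verts_below x)"
  shows "\<exists>t. ereal t < x \<and> (\<forall>s\<ge>t. word_map u s = s)"
  using assms(2)
proof (induction u)
  case Nil
  show ?case using assms(1)
  proof (cases x rule: dy_verts_cases)
    case (dyadic r)
    then show ?thesis by (intro exI[of _ "r - 1"]) simp
  qed auto
next
  case (Cons a u)
  then obtain t where t: "ereal t < x" "\<forall>s\<ge>t. word_map u s = s" by auto
  have y: "fst a \<in> dy_verts" "fst a < x" using Cons.prems by auto
  then obtain r where r: "fst a = ereal r" by (cases "fst a" rule: dy_verts_cases) auto
  have "word_map (a # u) s = s" if "s \<ge> max t r" for s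
  proof -
    have h: "vertex_map (fst a) s = s" using vertex_map_right[OF y(1), of s] r that by simp
    then have "finv (vertex_map (fst a)) s = s"
      using line_homeo_finv_f[OF line_homeo_vertex_map[OF y(1)], of s] by simp
    then show ?thesis using h t that by simp
  qed
  moreover have "ereal (max t r) < x" using t r y by (simp add: max_def)
  ultimately show ?case by blast
qed

text \<open>A positive letter \<open>x\<close> moves every point below \<open>x\<close> down, an inverse one moves it up without leaving the
  points below \<open>x\<close>.\<close>

lemma word_map_replicate_moves:
  assumes "x \<in> dy_verts" "ereal t < x"
  shows "word_map (replicate (Suc n) (x, e)) t \<noteq> t"
proof (cases e)
  case True
  have "word_map (replicate n (x, True)) t \<le> t" for n
  proof (induction n)
    case (Suc n)
    then have "ereal (word_map (replicate n (x, True)) t) \<le> ereal t" by simp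
    then have "ereal (word_map (replicate n (x, True)) t) < x" using assms(2) by (rule le_less_trans)
    then show ?case using vertex_map_less[OF assms(1)] Suc by fastforce
  qed simp
  note le = this[of n]
  then have "ereal (word_map (replicate n (x, True)) t) \<le> ereal t" by simp
  then have "ereal (word_map (replicate n (x, True)) t) < x" using assms(2) by (rule le_less_trans)
  then show ?thesis using True le vertex_map_less[OF assms(1)] by fastforce
next
  case False
  note L = line_homeo_vertex_map[OF assms(1)]
  have step: "s < finv (vertex_map x) s \<and> ereal (finv (vertex_map x) s) < x" if "ereal s < x" for s
  proof -
    let ?r = "finv (vertex_map x) s"
    have r: "vertex_map x ?r = s" using L by simp
    have "ereal ?r < x" using vertex_map_right[OF assms(1), of ?r] that r by (metis not_le)
    then show ?thesis using vertex_map_less[OF assms(1), of ?r] r by simp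
  qed
  have "t \<le> word_map (replicate n (x, False)) t \<and> ereal (word_map (replicate n (x, False)) t) < x"
  proof (induction n)
    case (Suc n)
    then show ?case using step[of "word_map (replicate n (x, False)) t"] by simp
  qed (use assms in simp)
  then show ?thesis using False step[of "word_map (replicate n (x, False)) t"] by simp
qed

text \<open>Write the word as \<open>u x\<^sup>n\<close> with \<open>x\<close> its largest vertex. At a point close to \<open>x\<close> that \<open>u\<close> fixes, \<open>x\<^sup>n\<close>
  must act trivially as well, since \<open>u\<close> is injective; so \<open>n = 0\<close> and \<open>u\<close> is a shorter word.\<close>

lemma trivial_word_map:
  assumes "w \<in> words dy_verts" "word_map w = id"
  shows "w \<approx>\<^sub>T []"
  using assms
proof (induction "length w" arbitrary: w rule: less_induct)
  case less
  show ?case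
  proof (cases "w = []")
    case False
    define x where "x = Max (fst ` set w)"
    have xin: "x \<in> fst ` set w" unfolding x_def using False by (intro Max_in) auto
    have sub: "fst ` set w \<subseteq> dy_verts" using less.prems(1) by (induction w) auto
    then have x: "x \<in> dy_verts" using xin by blast
    have "fst a \<le> x" if "a \<in> set w" for a unfolding x_def using that by (intro Max_ge) auto
    then have "w \<in> words {y \<in> dy_verts. y \<le> x}" using sub by (auto simp: words_def in_lists_conv_set)
    then obtain u P where u: "u \<in> words (dy_verts_below x)" and P: "P \<in> words {x}"
      and len: "length u = length (filter (\<lambda>a. fst a \<noteq> x) w)" and w: "w \<approx>\<^sub>T u @ P"
      using collect_letter[OF x] by blast
    note uV = words_below[OF u]
    obtain n e where ne: "P \<approx>\<^sub>T replicate n (x, e)" using pres_eq_replicate[OF x P] by blast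
    have w': "w \<approx>\<^sub>T u @ replicate n (x, e)"
      using pres_eq.trans[OF w] pres_eq_context[OF ne, of u "[]"] uV by simp
    then have id: "word_map u \<circ> word_map (replicate n (x, e)) = id"
      using word_map_cong less.prems(2) word_map_append by metis
    have "n = 0"
    proof (rule ccontr)
      assume "n \<noteq> 0"
      then obtain m where m: "n = Suc m" using not0_implies_Suc by blast
      obtain t where t: "ereal t < x" "\<forall>s\<ge>t. word_map u s = s"
        using word_map_below_fixes[OF x u] by blast
      have "word_map u (word_map (replicate n (x, e)) t) = word_map u t"
        using fun_cong[OF id, of t] t by simp
      then have "word_map (replicate n (x, e)) t = t"
        using injD[OF line_homeo_inj[OF line_homeo_word_map[OF uV]]] by blast
      then show False using word_map_replicate_moves[OF x t(1)] m by blast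
    qed
    then have wu: "w \<approx>\<^sub>T u" using w' by simp
    have "length u < length w" unfolding len using xin by (auto intro: length_filter_less)
    moreover have "word_map u = id" using word_map_cong[OF wu] less.prems(2) by simp
    ultimately have "u \<approx>\<^sub>T []" using less.hyps uV by blast
    then show ?thesis using wu pres_eq.trans by blast
  qed (simp add: pres_eq.refl)
qed

text \<open>A left inverse \<open>p\<close> of \<open>v\<close> is also one of \<open>u\<close>, because \<open>p u\<close> acts trivially; cancel \<open>p\<close>.\<close>

lemma word_map_injective:
  assumes "u \<in> words dy_verts" "v \<in> words dy_verts" "word_map u = word_map v"
  shows "u \<approx>\<^sub>T v"
proof -
  obtain p where p: "p \<in> words dy_verts" "p @ v \<approx>\<^sub>T []" using pres_left_inverse[OF assms(2)] by blast
  obtain q where q: "q \<in> words dy_verts" "q @ p \<approx>\<^sub>T []" using pres_left_inverse[OF p(1)] by blast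
  have "word_map (p @ u) = id"
    using word_map_cong[OF p(2)] assms(3) by (simp add: word_map_append)
  then have pu: "p @ u \<approx>\<^sub>T []" using p assms by (intro trivial_word_map) auto
  have cancel: "y \<approx>\<^sub>T q" if "y \<in> words dy_verts" "p @ y \<approx>\<^sub>T []" for y
  proof -
    have 1: "q @ p @ y \<approx>\<^sub>T y" using pres_eq_context[OF q(2), of "[]" y] that by simp
    have 2: "q @ p @ y \<approx>\<^sub>T q" using pres_eq_context[OF that(2), of q "[]"] q by simp
    show ?thesis by (rule pres_eq.trans[OF pres_eq.sym[OF 1] 2])
  qed
  show ?thesis by (rule pres_eq.trans[OF cancel[OF assms(1) pu] pres_eq.sym[OF cancel[OF assms(2) p(2)]]])
qed


section \<open>Generation of Thompson's group\<close>

definition word_maps :: "(real \<Rightarrow> real) set" where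
  "word_maps = word_map ` words dy_verts"

lemma word_maps_comp: "f \<in> word_maps \<Longrightarrow> g \<in> word_maps \<Longrightarrow> f \<circ> g \<in> word_maps"
  unfolding word_maps_def using word_map_append by (auto simp del: o_apply) (metis image_eqI words_append)

lemma word_maps_line_homeo: "f \<in> word_maps \<Longrightarrow> line_homeo f"
  by (auto simp: word_maps_def line_homeo_word_map)

lemma word_maps_finv:
  assumes "f \<in> word_maps"
  shows "finv f \<in> word_maps"
proof -
  obtain w where w: "w \<in> words dy_verts" "f = word_map w" using assms by (auto simp: word_maps_def)
  obtain v where v: "v \<in> words dy_verts" "v @ w \<approx>\<^sub>T []" using pres_left_inverse[OF w(1)] by blast
  have id: "word_map v \<circ> f = id" using word_map_cong[OF v(2)] w by (simp add: word_map_append)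
  have "finv f t = word_map v t" for t
  proof -
    have "word_map v (f (finv f t)) = finv f t" using fun_cong[OF id, of "finv f t"] by simp
    then show ?thesis using word_maps_line_homeo[OF assms] by simp
  qed
  then have "finv f = word_map v" by blast
  then show ?thesis using v by (simp add: word_maps_def)
qed

lemma vertex_map_in_word_maps: "x \<in> dy_verts \<Longrightarrow> vertex_map x \<in> word_maps"
  unfolding word_maps_def by (intro image_eqI[of _ _ "[(x, True)]"]) auto

lemma int_shift_in_word_maps: "int_shift m \<in> word_maps"
  using vertex_map_in_word_maps[of "ereal (of_int m)"] by (simp add: dy_homeo_of_int)

lemma word_maps_cancel_right:
  assumes "f \<circ> g \<in> word_maps" "g \<in> word_maps"
  shows "f \<in> word_maps"
proof -
  have "f \<circ> g \<circ> finv g = f" using word_maps_line_homeo[OF assms(2)] by (simp add: fun_eq_iff)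
  then show ?thesis using word_maps_comp[OF assms(1) word_maps_finv[OF assms(2)]] by simp
qed

lemma translation_in_word_maps: "(\<lambda>t. t + of_int d) \<in> word_maps"
proof (induction d rule: int_induct[where k = 0])
  case base
  have "id \<in> word_maps" unfolding word_maps_def by (intro image_eqI[of _ _ "[]"]) auto
  then show ?case by (simp add: id_def)
next
  case (step1 i)
  have T: "(\<lambda>t. t - 1) \<in> word_maps" using vertex_map_in_word_maps[of "\<infinity>"] by simp
  have "(\<lambda>t. t + of_int (i + 1)) \<circ> (\<lambda>t. t - 1) = (\<lambda>t. t + of_int i :: real)" by (simp add: fun_eq_iff)
  then show ?case using word_maps_cancel_right[OF _ T] step1 by metis
next
  case (step2 i)
  have T: "(\<lambda>t. t - 1) \<in> word_maps" using vertex_map_in_word_maps[of "\<infinity>"] by simp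
  have "(\<lambda>t. t + of_int i :: real) \<circ> (\<lambda>t. t - 1) = (\<lambda>t. t + of_int (i - 1))" by (simp add: fun_eq_iff)
  then show ?case using word_maps_comp[OF step2(2) T] by metis
qed

text \<open>Both sides are the numerator over \<open>2\<^sup>n\<close> of the common endpoint of the two images.\<close>

lemma maps_standard_consecutive:
  assumes "maps_standard g m 0 c k" "maps_standard g (m + 1) 0 d l" "k \<le> n" "l \<le> n"
  shows "(c + 1) * 2 ^ (n - k) = d * 2 ^ (n - l)"
proof -
  have "g (of_int m + 1) = (of_int c + 1) / 2 ^ k" using assms(1) by (simp add: maps_standard_def)
  moreover have "g (of_int m + 1) = of_int d / 2 ^ l" using assms(2) by (simp add: maps_standard_def)
  ultimately have "(of_int c + 1) / 2 ^ k * 2 ^ n = of_int d / 2 ^ l * (2 :: real) ^ n" by simp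
  moreover have "(2 :: real) ^ n / 2 ^ k = 2 ^ (n - k)" "(2 :: real) ^ n / 2 ^ l = 2 ^ (n - l)"
    using assms(3,4) by (simp_all add: power_diff)
  ultimately have "(of_int c + 1) * 2 ^ (n - k) = of_int d * (2 :: real) ^ (n - l)"
    by (metis times_divide_eq_left times_divide_eq_right)
  then have "real_of_int ((c + 1) * 2 ^ (n - k)) = of_int (d * 2 ^ (n - l))" by simp
  then show ?thesis by (simp only: of_int_eq_iff)
qed

lemma maps_standard_unit_length:
  assumes "maps_standard g m 0 c k" "g (of_int m + 1) = g (of_int m) + 1"
  shows "k = 0"
proof -
  have "g (of_int m + 1) = (of_int c + 1) / 2 ^ k" "g (of_int m) = of_int c / 2 ^ k"
    using assms(1) by (simp_all add: maps_standard_def)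
  with assms(2) have "(2 :: real) ^ k = 1" by (simp add: field_simps)
  moreover have "(1 :: real) < 2 ^ k" if "k \<noteq> 0" using that by (simp add: one_less_power)
  ultimately show ?thesis by (metis less_irrefl)
qed

text \<open>Take an image of minimal length. If its left endpoint has an even numerator it is a left half, and by
  parity the next image cannot be longer; otherwise the same argument applies to the previous image.\<close>

lemma sibling_intervals:
  assumes g: "\<And>m. maps_standard g m 0 (c m) (k m)" and max: "\<And>m. k m \<le> k i" and "k i > 0"
  shows "\<exists>i. (\<forall>m. k m \<le> k i) \<and> k i > 0 \<and> k (i + 1) = k i \<and> c (i + 1) = c i + 1 \<and> even (c i)"
proof (cases "even (c i)")
  case True
  have eq: "c i + 1 = c (i + 1) * 2 ^ (k i - k (i + 1))"
    using maps_standard_consecutive[OF g[of i] g[of "i + 1"], of "k i"] max by simp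
  have "k i - k (i + 1) = 0"
  proof (rule ccontr)
    assume "k i - k (i + 1) \<noteq> 0"
    then have "even (c i + 1)" unfolding eq by simp
    then show False using True by simp
  qed
  then have "k (i + 1) = k i" using max[of "i + 1"] by simp
  then show ?thesis using eq True assms(3) max by (intro exI[of _ i]) simp
next
  case False
  have eq: "(c (i - 1) + 1) * 2 ^ (k i - k (i - 1)) = c i"
    using maps_standard_consecutive[OF g[of "i - 1"], of "c i" "k i" "k i"] g[of i] max by simp
  have "k i - k (i - 1) = 0"
  proof (rule ccontr)
    assume "k i - k (i - 1) \<noteq> 0"
    then have "even (c i)" unfolding eq[symmetric] by simp
    then show False using False by simp
  qed
  then have k: "k (i - 1) = k i" using max[of "i - 1"] by simp
  then have "c i = c (i - 1) + 1" using eq by simp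
  then show ?thesis using k False assms(3) max by (intro exI[of _ "i - 1"]) auto
qed

text \<open>Consecutive images of length one differ by one.\<close>

lemma unit_maps_translation:
  assumes g: "\<And>m. maps_standard g m 0 (c m) 0"
  shows "g = (\<lambda>t. t + of_int (c 0))"
proof
  fix t :: real
  have step: "c (m + 1) = c m + 1" for m
    using maps_standard_consecutive[OF g[of m] g[of "m + 1"], of 0] by simp
  have c: "c m = c 0 + m" for m
  proof (induction m rule: int_induct[where k = 0])
    case (step1 i)
    then show ?case using step[of i] by simp
  next
    case (step2 i)
    then show ?case using step[of "i - 1"] by simp
  qed simp
  have "of_int \<lfloor>t\<rfloor> \<le> t" "t \<le> of_int \<lfloor>t\<rfloor> + 1" by linarith+
  then show "g t = t + of_int (c 0)"
    using g[of "\<lfloor>t\<rfloor>"] c[of "\<lfloor>t\<rfloor>"] by (simp add: maps_standard_def)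
qed

text \<open>Composing with \<open>int_shift (i + 2)\<close> stretches the unit interval before \<open>i + 2\<close> over the two unit
  intervals before \<open>i + 2\<close>. If their images are the two halves of a standard interval, the composition
  again has standard images. Everything to the left has been shifted, so the stretch where the map
  is not known to be a translation has become shorter by one.\<close>

lemma standard_unit_images_in_word_maps:
  assumes "\<And>m. maps_standard g m 0 (c m) (k m)"
    and "\<And>t. t \<le> of_int A \<Longrightarrow> g t = t + of_int a" "\<And>t. of_int B \<le> t \<Longrightarrow> g t = t + of_int b"
  shows "g \<in> word_maps"
  using assms
proof (induction "nat (B - A)" arbitrary: g c k A a rule: less_induct)
  case less
  note g = less.prems(1) and left = less.prems(2) and right = less.prems(3)
  have support: "A \<le> m \<and> m + 1 \<le> B" if "k m > 0" for m
  proof (rule ccontr)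
    assume "\<not> (A \<le> m \<and> m + 1 \<le> B)"
    then consider "m + 1 \<le> A" | "B \<le> m" by linarith
    then have "g (of_int m + 1) = g (of_int m) + 1"
    proof cases
      case 1
      then have "real_of_int (m + 1) \<le> of_int A" by (simp only: of_int_le_iff)
      then show ?thesis using left[of "of_int m"] left[of "of_int m + 1"] by simp
    next
      case 2
      then have "real_of_int B \<le> of_int m" by (simp only: of_int_le_iff)
      then show ?thesis using right[of "of_int m"] right[of "of_int m + 1"] by simp
    qed
    then show False using maps_standard_unit_length[OF g[of m]] that by simp
  qed
  show ?case
  proof (cases "\<forall>m. k m = 0")
    case True
    then have "maps_standard g m 0 (c m) 0" for m using g[of m] by simp
    then have "g = (\<lambda>t. t + of_int (c 0))" by (rule unit_maps_translation)
    then show ?thesis using translation_in_word_maps[of "c 0"] by simp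
  next
    case False
    then obtain m0 where m0: "k m0 > 0" by auto
    \<comment> \<open>Outside of \<open>[A, B]\<close> all images have length one, so a minimal length exists.\<close>
    define K where "K = Max (k ` {A..B})"
    have "k m0 \<in> k ` {A..B}" using support[OF m0] by (intro imageI) simp
    then have "K \<in> k ` {A..B}" unfolding K_def by (intro Max_in finite_imageI) (simp, blast)
    then obtain i0 where i0: "k i0 = K" by blast
    have max: "k m \<le> k i0" for m
    proof (cases "k m > 0")
      case True
      then have "k m \<in> k ` {A..B}" using support[OF True] by (intro imageI) simp
      then show ?thesis unfolding i0 K_def by (intro Max_ge) auto
    qed simp
    have "k i0 > 0" using max[of m0] m0 by simp
    from sibling_intervals[OF g max this]
    obtain i where "(\<forall>m. k m \<le> k i) \<and> k i > 0 \<and> k (i + 1) = k i \<and>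
        c (i + 1) = c i + 1 \<and> even (c i)" ..
    then have i: "k i > 0" "k (i + 1) = k i" "c (i + 1) = c i + 1" "even (c i)" by auto
    obtain n where n: "k i = Suc n" using i(1) gr0_implies_Suc by blast
    obtain p where p: "c i = 2 * p" using i(4) by (elim evenE)
    have iA: "A \<le> i" and iB: "i + 2 \<le> B" using support[of i] support[of "i + 1"] i by auto
    let ?h = "int_shift (i + 2)"
    define c' where "c' j = (if j \<le> i then c (j - 1) else if j = i + 1 then p else c j)" for j
    define k' where "k' j = (if j \<le> i then k (j - 1) else if j = i + 1 then n else k j)" for j
    have gh: "maps_standard (g \<circ> ?h) j 0 (c' j) (k' j)" for j
      unfolding maps_standard_def
    proof (intro allI impI)
      fix t :: real
      assume t: "of_int j \<le> 2 ^ 0 * t \<and> 2 ^ 0 * t \<le> of_int j + 1"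
      consider "j \<le> i" | "j = i + 1" | "i + 2 \<le> j" by linarith
      then show "(g \<circ> ?h) t = (of_int (c' j) + (2 ^ 0 * t - of_int j)) / 2 ^ k' j"
      proof cases
        case 1
        then have "real_of_int j \<le> of_int i" by (simp only: of_int_le_iff)
        then have "?h t = t - 1" using t by (intro int_shift_left) simp
        then show ?thesis using g[of "j - 1"] 1 t by (simp add: maps_standard_def c'_def k'_def)
      next
        case 2
        then have "?h t = 2 * t - of_int (i + 2)" using t by (intro int_shift_middle) simp_all
        then have h: "?h t = 2 * t - of_int i - 2" by simp
        have "g (?h t) = (of_int (c i) + (?h t - of_int i)) / 2 ^ k i"
        proof (cases "?h t \<le> of_int i + 1")
          case True
          then show ?thesis using g[of i] t 2 h by (simp add: maps_standard_def)
        next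
          case False
          then show ?thesis using g[of "i + 1"] t 2 h i by (simp add: maps_standard_def)
        qed
        also have "\<dots> = (of_int p + (t - of_int j)) / 2 ^ n"
          unfolding h n p 2 by (simp add: field_simps)
        finally show ?thesis using 2 by (simp add: c'_def k'_def)
      next
        case 3
        then have "real_of_int (i + 2) \<le> of_int j" by (simp only: of_int_le_iff)
        then have "?h t = t" using t by (intro int_shift_right) simp
        then show ?thesis using g[of j] 3 t by (simp add: maps_standard_def c'_def k'_def)
      qed
    qed
    have ghl: "(g \<circ> ?h) t = t + of_int (a - 1)" if "t \<le> of_int (A + 1)" for t
    proof -
      have "real_of_int A \<le> of_int i" using iA by (simp only: of_int_le_iff)
      then have "?h t = t - 1" using that by (intro int_shift_left) simp
      then show ?thesis using left[of "t - 1"] that by simp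
    qed
    have ghr: "(g \<circ> ?h) t = t + of_int b" if "of_int B \<le> t" for t
    proof -
      have "real_of_int (i + 2) \<le> of_int B" using iB by (simp only: of_int_le_iff)
      then have "?h t = t" using that by (intro int_shift_right) simp
      then show ?thesis using right[of t] that by simp
    qed
    have "nat (B - (A + 1)) < nat (B - A)" using iA iB by simp
    then have "g \<circ> ?h \<in> word_maps" using gh ghl ghr by (rule less.hyps)
    then show ?thesis using int_shift_in_word_maps by (rule word_maps_cancel_right)
  qed
qed

lemma maps_standard_integer_translation:
  assumes "\<And>t. of_int m \<le> t \<Longrightarrow> t \<le> of_int m + 1 \<Longrightarrow> f t = t + of_int a"
  shows "maps_standard f m 0 (m + a) 0"
  using assms by (simp add: maps_standard_def)

text \<open>The map \<open>p\<close> contracts unit intervals to length \<open>1/2\<^sup>N\<close> until the interval from \<open>A\<close> to \<open>B\<close> is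
  covered, and is a translation elsewhere. Outside of that interval \<open>f\<close> is a translation, and inside
  \<open>N\<close> is large enough for \<open>f\<close> to have standard images.\<close>

lemma thompson_like_in_word_maps:
  assumes "thompson_like f"
  shows "f \<in> word_maps"
proof -
  obtain N where N: "\<And>n j. n \<ge> N \<Longrightarrow> \<exists>c k. n \<le> k + N \<and> k \<le> n + N \<and> maps_standard f j n c k"
    using assms unfolding thompson_like_def dyadic_PL_def by blast
  obtain A B0 a b :: int where left: "\<And>t. t \<le> of_int A \<Longrightarrow> f t = t + of_int a"
    and right0: "\<And>t. t \<ge> of_int B0 \<Longrightarrow> f t = t + of_int b"
    using assms unfolding thompson_like_def integer_translation_ends_def by blast
  define B where "B = max A B0"
  have right: "f t = t + of_int b" if "t \<ge> of_int B" for t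
    using right0[of t] that by (simp add: B_def)
  \<comment> \<open>There are \<open>(B - A) 2\<^sup>N\<close> intervals of length \<open>1/2\<^sup>N\<close> from \<open>A\<close> to \<open>B\<close>, and \<open>D\<close> leaves
    room for as many unit intervals up to \<open>B\<close>.\<close>
  define D where "D = B - (B - A) * 2 ^ N"
  have DB: "D \<le> B" by (simp add: D_def B_def)
  define p where "p t = (if of_int B \<le> t then t else if of_int D \<le> t then of_int B + (t - of_int B) / 2 ^ N
    else t - of_int D + of_int A)" for t :: real
  have pD: "of_int B + (of_int D - of_int B) / 2 ^ N = (of_int A :: real)" by (simp add: D_def)
  define c where "c m = (if B \<le> m then m else if D \<le> m then B * 2 ^ N + m - B else m - D + A)" for m
  define k where "k m = (if B \<le> m \<or> m < D then 0 else N)" for m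
  have p: "maps_standard p m 0 (c m) (k m)" for m
    unfolding maps_standard_def
  proof (intro allI impI)
    fix t :: real
    assume t: "of_int m \<le> 2 ^ 0 * t \<and> 2 ^ 0 * t \<le> of_int m + 1"
    consider "B \<le> m" | "D \<le> m" "m + 1 \<le> B" | "m + 1 \<le> D" using DB by linarith
    then show "p t = (of_int (c m) + (2 ^ 0 * t - of_int m)) / 2 ^ k m"
    proof cases
      case 1
      then have "real_of_int B \<le> of_int m" by (simp only: of_int_le_iff)
      then show ?thesis using t 1 by (simp add: p_def c_def k_def)
    next
      case 2
      then have le: "real_of_int D \<le> of_int m" "real_of_int (m + 1) \<le> of_int B"
        by (simp_all only: of_int_le_iff)
      have "p t = of_int B + (t - of_int B) / 2 ^ N"
        using t le by (cases "t = of_int B") (auto simp: p_def)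
      then show ?thesis using 2 by (simp add: c_def k_def field_simps)
    next
      case 3
      then have le: "real_of_int (m + 1) \<le> of_int D" by (simp only: of_int_le_iff)
      have DB': "real_of_int D \<le> of_int B" using DB by simp
      have "p t = t - of_int D + of_int A"
      proof (cases "t = of_int D")
        case True
        then show ?thesis using pD DB' by (cases "D = B") (auto simp: p_def D_def)
      next
        case False
        then show ?thesis using t le DB' by (simp add: p_def)
      qed
      then show ?thesis using 3 DB by (simp add: c_def k_def)
    qed
  qed
  have pleft: "p t = t + of_int (A - D)" if "t \<le> of_int D" for t
  proof (cases "t = of_int D")
    case True
    then show ?thesis using p[of "D - 1"] DB by (simp add: maps_standard_def c_def k_def)
  next
    case False
    then show ?thesis using that DB by (simp add: p_def)
  qed
  have pright: "p t = t + of_int 0" if "of_int B \<le> t" for t using that by (simp add: p_def)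
  have P: "p \<in> word_maps" using p pleft pright by (rule standard_unit_images_in_word_maps)
  have "\<exists>d l. maps_standard (f \<circ> p) m 0 d l" for m
  proof -
    have "\<exists>d l. maps_standard f (c m) (k m) d l"
    proof (cases "B \<le> m \<or> m < D")
      case True
      have "\<exists>d. maps_standard f (c m) 0 (c m + d) 0"
      proof (cases "B \<le> m")
        case True
        then have "real_of_int B \<le> of_int m" by (simp only: of_int_le_iff)
        then have "maps_standard f m 0 (m + b) 0"
          by (intro maps_standard_integer_translation right) simp
        then show ?thesis using True by (auto simp: c_def)
      next
        case False
        then have "c m + 1 \<le> A" using True DB by (auto simp: c_def)
        then have "real_of_int (c m + 1) \<le> of_int A" by (simp only: of_int_le_iff)
        then have "maps_standard f (c m) 0 (c m + a) 0"
          by (intro maps_standard_integer_translation left) simp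
        then show ?thesis by blast
      qed
      then show ?thesis using True by (auto simp: k_def)
    next
      case False
      then show ?thesis using N[of N "c m"] by (auto simp: k_def)
    qed
    then show ?thesis using maps_standard_comp[OF p] by blast
  qed
  then obtain d l where fp: "\<And>m. maps_standard (f \<circ> p) m 0 (d m) (l m)" by metis
  have fleft: "(f \<circ> p) t = t + of_int (A - D + a)" if "t \<le> of_int D" for t
    using pleft[OF that] left[of "p t"] that by simp
  have fright: "(f \<circ> p) t = t + of_int b" if "of_int B \<le> t" for t
    using pright[OF that] right[of "p t"] that by simp
  have "f \<circ> p \<in> word_maps" using fp fleft fright by (rule standard_unit_images_in_word_maps)
  then show ?thesis using P by (rule word_maps_cancel_right)
qed


section \<open>The isomorphism\<close>

text \<open>All words of a class act in the same way, so any representative can be chosen.\<close>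

definition class_map :: "ereal word set \<Rightarrow> real \<Rightarrow> real" where
  "class_map U = word_map (SOME u. u \<in> U)"

lemma class_map_pres_class:
  assumes "u \<in> words dy_verts"
  shows "class_map (pres_class dy_verts dy_relations u) = word_map u"
proof -
  have "u \<approx>\<^sub>T (SOME v. v \<in> pres_class dy_verts dy_relations u)"
    using someI[of "\<lambda>v. v \<in> pres_class dy_verts dy_relations u" u] pres_eq.refl[OF assms]
    by (auto simp: pres_class_def)
  then show ?thesis unfolding class_map_def by (rule word_map_cong[symmetric])
qed

lemma class_map_iso: "class_map \<in> iso (trickle_group dyadic_trickle_graph) thompson_F"
proof -
  let ?c = "pres_class dy_verts dy_relations"
  let ?G = "presented_group dy_verts dy_relations"
  have car: "carrier ?G = ?c ` words dy_verts" by (simp add: presented_group_def)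
  have F: "carrier thompson_F = {f. thompson_like f}" "mult thompson_F = (\<circ>)"
    by (simp_all add: thompson_F_def thompson_map_iff)
  have "class_map \<in> hom ?G thompson_F"
  proof (rule homI)
    fix U assume "U \<in> carrier ?G"
    then show "class_map U \<in> carrier thompson_F"
      by (auto simp: car F class_map_pres_class thompson_like_word_map)
  next
    fix U W assume "U \<in> carrier ?G" "W \<in> carrier ?G"
    then show "class_map (U \<otimes>\<^bsub>?G\<^esub> W) = class_map U \<otimes>\<^bsub>thompson_F\<^esub> class_map W"
      by (auto simp: car F class_map_pres_class pres_class_mult word_map_append)
  qed
  moreover have "bij_betw class_map (carrier ?G) (carrier thompson_F)"
    unfolding bij_betw_def
  proof
    show "inj_on class_map (carrier ?G)"
      by (rule inj_onI) (auto simp: car class_map_pres_class intro!: pres_class_eqI word_map_injective)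
    have "class_map ` carrier ?G = word_maps"
      unfolding car word_maps_def image_image by (rule image_cong) (simp_all add: class_map_pres_class)
    also have "\<dots> = carrier thompson_F"
      using thompson_like_in_word_maps thompson_like_word_map by (auto simp: F word_maps_def)
    finally show "class_map ` carrier ?G = carrier thompson_F" .
  qed
  ultimately show ?thesis by (simp add: iso_def trickle_group_dyadic)
qed

theorem theorem3p15:
  shows "trickle_graph dyadic_trickle_graph \<and>
    trickle_group dyadic_trickle_graph \<cong> thompson_F"
  using trickle_graph_dyadic class_map_iso by (auto simp: is_iso_def)

end
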